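(* Let $\mathcal D$ be a data-system over a constructor vocabulary $\mathcal C$ and $n\ge1$. For every $\Sigma_n$ type $\mathbf D$ of $\mathcal D$ there is a $\Sigma^0_n$ formula $\mathbf D^*[g]$, and for every $\Pi_n$ type $\mathbf D$ there is a $\Pi^0_n$ formula $\mathbf D^*[g]$, with a single free unary function variable $g$, such that for every function $h:\mathbb N\to\mathbb N$ representing a hyper-term $t$: $\mathbf D^*[h]$ is true (in the standard model) iff $t\in\mathbf D_{\mathcal A}$.
   Context: A constructor vocabulary $\mathcal C$ is a finite set of constructors (function symbols with arities $\ge0$). A hyper-term is a possibly infinite ordered tree labelled by constructors, a node labelled by a constructor of arity $r$ having exactly $r$ children; $\mathcal H(\mathcal C)$ is the set of hyper-terms. A constructor-statement for $x$ is $\exists y_1\dots y_r(x=\mathbf c(y_1,\dots,y_r)\wedge\mathbf Q_1(y_1)\wedge\cdots\wedge\mathbf Q_r(y_r))$ with $\mathbf c$ of arity $r$, distinct $y_i$, and unary type-identifiers $\mathbf Q_i$. A data-system $\mathcal D$ is a finite sequence of bundles $\vec{\mathbf D}_1,\dots,\vec{\mathbf D}_k$ (finite lists of type-identifiers), each designated inductive or coinductive: an inductive bundle $\vec{\mathbf D}_i$ has a set of construction rules $\forall\vec y(\mathbf Q_1(y_1)\wedge\cdots\wedge\mathbf Q_r(y_r)\rightarrow\mathbf D(\mathbf c(\vec y)))$ with $\mathbf D$ in $\vec{\mathbf D}_i$, $\mathbf Q_j$ in $\vec{\mathbf D}_1,\dots,\vec{\mathbf D}_i$; a coinductive bundle has,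 for each $\mathbf D$ in it, a deconstruction rule $\forall x(\mathbf D(x)\rightarrow\psi_1\vee\cdots\vee\psi_l)$, $\psi_j$ constructor-statements for $x$ over types in $\vec{\mathbf D}_1,\dots,\vec{\mathbf D}_i$. The canonical model $\mathcal A$: universe $\mathcal H(\mathcal C)$, constructors interpreted as tree formation, each inductive bundle interpreted as the least tuple of sets of hyper-terms closed under its construction rules, each coinductive bundle as the greatest tuple of sets of hyper-terms every element of whose $j$-th component satisfies the right-hand side of the deconstruction rule of its $j$-th identifier (earlier bundles interpreted as already determined); $\mathbf D_{\mathcal A}$ is the interpretation of $\mathbf D$. Ranks: a single inductive (coinductive) bundle is $\Sigma_1$ ($\Pi_1$); if $\vec{\mathbf D}_1,\dots,\vec{\mathbf D}_k$ is $\Sigma_n$, then appending an inductive bundle gives $\Sigma_n$ and a coinductive one gives $\Pi_{n+1}$; if it is $\Pi_n$, appending a coinductive bundle gives $\Pi_n$ and an inductive one gives $\Sigma_{n+1}$. A type-identifier of bundle $\vec{\mathbf D}_i$ is a $\Sigma_n$ (resp. $\Pi_n$) type if $\vec{\mathbf D}_1,\dots,\vec{\mathbf D}_i$ is $\Sigma_n$ (resp. $\Pi_n$). Representation: fix a primitive recursive coding $\langle\cdots\rangle$ of finite sequences of naturals and distinct numeric codes $\mathbf c^\sharp$ of constructors; an address is a coded sequence of child indices (starting at $0$). A function $h:\mathbb N\to\mathbb N$ represents the hyper-term $t$ if, for every address $a$ at which $t$ has a node, $h(a)=\mathbf c^\sharp$ with $\mathbf c$ the constructor of $t$ at $a$.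 A $\Sigma^0_n$ (resp. $\Pi^0_n$) formula with function parameter $g$ is one consisting of $n$ alternating blocks of number quantifiers, beginning with $\exists$ (resp. $\forall$), followed by a matrix that is primitive recursive in its number variables and $g$. *)

theory Defs imports Main begin

section \<open>Hyper-terms\<close>

codatatype 'c hterm = Node 'c "'c hterm list"

text \<open>The hyper-terms over the vocabulary with constructor set \<open>C\<close> and arities \<open>ar\<close>.
  Being coinductive, the definition admits infinite trees.\<close>

coinductive_set hyperterms :: "'c set \<Rightarrow> ('c \<Rightarrow> nat) \<Rightarrow> 'c hterm set"
  for C :: "'c set" and ar :: "'c \<Rightarrow> nat" where
  "\<lbrakk>c \<in> C; length ts = ar c; \<forall>t\<in>set ts. t \<in> hyperterms C ar\<rbrakk> \<Longrightarrow> Node c ts \<in> hyperterms C ar"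

text \<open>\<open>label_at t a\<close> is \<open>None\<close> if \<open>t\<close> has no node at address \<open>a\<close>.\<close>

fun label_at :: "'c hterm \<Rightarrow> nat list \<Rightarrow> 'c option" where
  "label_at (Node c ts) [] = Some c"
| "label_at (Node c ts) (i # a) = (if i < length ts then label_at (ts ! i) a else None)"


section \<open>Data-systems\<close>

text \<open>A pair \<open>(c, [Q\<^sub>1, \<dots>, Q\<^sub>r])\<close> stands for the constructor-statement
  \<open>\<exists>y\<^sub>1 \<dots> y\<^sub>r. x = c(y\<^sub>1, \<dots>, y\<^sub>r) \<and> Q\<^sub>1(y\<^sub>1) \<and> \<dots> \<and> Q\<^sub>r(y\<^sub>r)\<close>.\<close>

type_synonym ('c, 'd) cstatement = "'c \<times> 'd list"

text \<open>In \<open>Inductive Ds R\<close>, an element \<open>(D, c, [Q\<^sub>1, \<dots>, Q\<^sub>r])\<close> of \<open>R\<close> stands for the construction rule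
  \<open>\<forall>y\<^sub>1 \<dots> y\<^sub>r. Q\<^sub>1(y\<^sub>1) \<and> \<dots> \<and> Q\<^sub>r(y\<^sub>r) \<longrightarrow> D(c(y\<^sub>1, \<dots>, y\<^sub>r))\<close>.
  In \<open>Coinductive Ds \<psi>\<close>, the list \<open>\<psi> D\<close> contains the disjuncts of the deconstruction rule of \<open>D\<close>;
  only its values on \<open>Ds\<close> matter.\<close>

datatype ('c, 'd) type_bundle =
  Inductive "'d list" "('d \<times> 'c \<times> 'd list) set"
| Coinductive "'d list" "'d \<Rightarrow> ('c, 'd) cstatement list"

fun type_ids :: "('c, 'd) type_bundle \<Rightarrow> 'd list" where
  "type_ids (Inductive Ds R) = Ds"
| "type_ids (Coinductive Ds \<psi>) = Ds"

definition cstatement_ok :: "'c set \<Rightarrow> ('c \<Rightarrow> nat) \<Rightarrow> 'd set \<Rightarrow> ('c, 'd) cstatement \<Rightarrow> bool" where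
  "cstatement_ok C ar A = (\<lambda>(c, Qs). c \<in> C \<and> length Qs = ar c \<and> set Qs \<subseteq> A)"

text \<open>\<open>A\<close> is the set of type-identifiers which may be referred to.\<close>

fun bundle_ok :: "'c set \<Rightarrow> ('c \<Rightarrow> nat) \<Rightarrow> 'd set \<Rightarrow> ('c, 'd) type_bundle \<Rightarrow> bool" where
  "bundle_ok C ar A (Inductive Ds R) \<longleftrightarrow> (\<forall>(D, s)\<in>R. D \<in> set Ds \<and> cstatement_ok C ar A s)"
| "bundle_ok C ar A (Coinductive Ds \<psi>) \<longleftrightarrow> (\<forall>D\<in>set Ds. \<forall>s\<in>set (\<psi> D). cstatement_ok C ar A s)"

definition data_system :: "'c set \<Rightarrow> ('c \<Rightarrow> nat) \<Rightarrow> ('c, 'd) type_bundle list \<Rightarrow> bool" where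
  "data_system C ar Bs \<longleftrightarrow> distinct (concat (map type_ids Bs)) \<and>
    (\<forall>i<length Bs. bundle_ok C ar (\<Union>j\<le>i. set (type_ids (Bs ! j))) (Bs ! i))"


section \<open>The canonical model\<close>

type_synonym ('c, 'd) env = "'d \<Rightarrow> 'c hterm set"

text \<open>The truth of a constructor-statement for \<open>x\<close>, when type-identifiers are
  interpreted by \<open>\<sigma>\<close>.\<close>

definition cstatement_holds :: "('c, 'd) env \<Rightarrow> 'c hterm \<Rightarrow> ('c, 'd) cstatement \<Rightarrow> bool" where
  "cstatement_holds \<sigma> x = (\<lambda>(c, Qs). \<exists>ys. x = Node c ys \<and> list_all2 (\<lambda>y Q. y \<in> \<sigma> Q) ys Qs)"

definition closed_under :: "('d \<times> 'c \<times> 'd list) set \<Rightarrow> ('c, 'd) env \<Rightarrow> bool" where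
  "closed_under R \<sigma> \<longleftrightarrow>
    (\<forall>(D, c, Qs)\<in>R. \<forall>ys. list_all2 (\<lambda>y Q. y \<in> \<sigma> Q) ys Qs \<longrightarrow> Node c ys \<in> \<sigma> D)"

definition consistent_with ::
  "'d list \<Rightarrow> ('d \<Rightarrow> ('c, 'd) cstatement list) \<Rightarrow> ('c, 'd) env \<Rightarrow> bool" where
  "consistent_with Ds \<psi> \<sigma> \<longleftrightarrow> (\<forall>D\<in>set Ds. \<forall>x\<in>\<sigma> D. \<exists>s\<in>set (\<psi> D). cstatement_holds \<sigma> x s)"

text \<open>\<open>\<rho>\<close> interprets the identifiers of the earlier bundles, \<open>X\<close> ranges over the tuples of sets of
  hyper-terms that may interpret \<open>Ds\<close>, and \<open>override_on \<rho> X (set Ds)\<close> combines the two. The least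
  (greatest) tuple is the componentwise intersection (union) of all admissible ones.\<close>

fun interp_bundle ::
  "'c set \<Rightarrow> ('c \<Rightarrow> nat) \<Rightarrow> ('c, 'd) type_bundle \<Rightarrow> ('c, 'd) env \<Rightarrow> ('c, 'd) env" where
  "interp_bundle C ar (Inductive Ds R) \<rho> =
     override_on \<rho>
       (Inf {X. (\<forall>D\<in>set Ds. X D \<subseteq> hyperterms C ar) \<and> closed_under R (override_on \<rho> X (set Ds))})
       (set Ds)"
| "interp_bundle C ar (Coinductive Ds \<psi>) \<rho> =
     override_on \<rho>
       (Sup {X. (\<forall>D\<in>set Ds. X D \<subseteq> hyperterms C ar) \<and> consistent_with Ds \<psi> (override_on \<rho> X (set Ds))})
       (set Ds)"

definition canonical_interp ::
  "'c set \<Rightarrow> ('c \<Rightarrow> nat) \<Rightarrow> ('c, 'd) type_bundle list \<Rightarrow> ('c, 'd) env" where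
  "canonical_interp C ar Bs = fold (interp_bundle C ar) Bs (\<lambda>_. {})"


section \<open>Ranks\<close>

fun is_inductive :: "('c, 'd) type_bundle \<Rightarrow> bool" where
  "is_inductive (Inductive Ds R) \<longleftrightarrow> True"
| "is_inductive (Coinductive Ds \<psi>) \<longleftrightarrow> False"

inductive sigma_system :: "nat \<Rightarrow> ('c, 'd) type_bundle list \<Rightarrow> bool"
  and pi_system :: "nat \<Rightarrow> ('c, 'd) type_bundle list \<Rightarrow> bool" where
  "is_inductive B \<Longrightarrow> sigma_system 1 [B]"
| "\<not> is_inductive B \<Longrightarrow> pi_system 1 [B]"
| "\<lbrakk>sigma_system n Bs; is_inductive B\<rbrakk> \<Longrightarrow> sigma_system n (Bs @ [B])"
| "\<lbrakk>sigma_system n Bs; \<not> is_inductive B\<rbrakk> \<Longrightarrow> pi_system (n + 1) (Bs @ [B])"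
| "\<lbrakk>pi_system n Bs; \<not> is_inductive B\<rbrakk> \<Longrightarrow> pi_system n (Bs @ [B])"
| "\<lbrakk>pi_system n Bs; is_inductive B\<rbrakk> \<Longrightarrow> sigma_system (n + 1) (Bs @ [B])"

definition sigma_type :: "nat \<Rightarrow> ('c, 'd) type_bundle list \<Rightarrow> 'd \<Rightarrow> bool" where
  "sigma_type n Bs D \<longleftrightarrow>
    (\<exists>i<length Bs. D \<in> set (type_ids (Bs ! i)) \<and> sigma_system n (take (Suc i) Bs))"

definition pi_type :: "nat \<Rightarrow> ('c, 'd) type_bundle list \<Rightarrow> 'd \<Rightarrow> bool" where
  "pi_type n Bs D \<longleftrightarrow>
    (\<exists>i<length Bs. D \<in> set (type_ids (Bs ! i)) \<and> pi_system n (take (Suc i) Bs))"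


section \<open>Primitive recursion relative to a function variable\<close>

text \<open>Descriptions of functions primitive recursive in a unary function variable, which is denoted
  by \<open>Oracle\<close>.\<close>

datatype pr_fun =
  Zero
| Succ
| Proj nat
| Oracle
| Comp pr_fun "pr_fun list"
| Rec pr_fun pr_fun

inductive has_arity :: "pr_fun \<Rightarrow> nat \<Rightarrow> bool" where
  "has_arity Zero k"
| "has_arity Succ 1"
| "i < k \<Longrightarrow> has_arity (Proj i) k"
| "has_arity Oracle 1"
| "\<lbrakk>has_arity f (length fs); \<forall>f'\<in>set fs. has_arity f' k\<rbrakk> \<Longrightarrow> has_arity (Comp f fs) k"
| "\<lbrakk>has_arity f k; has_arity f' (k + 2)\<rbrakk> \<Longrightarrow> has_arity (Rec f f') (k + 1)"

text \<open>The value is meaningful only if the number of arguments is the arity. Recursion is on the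
  first argument; the step function takes the predecessor, the recursive value and the parameters.\<close>

fun pr_eval :: "(nat \<Rightarrow> nat) \<Rightarrow> pr_fun \<Rightarrow> nat list \<Rightarrow> nat" where
  "pr_eval g Zero xs = 0"
| "pr_eval g Succ xs = Suc (hd xs)"
| "pr_eval g (Proj i) xs = xs ! i"
| "pr_eval g Oracle xs = g (hd xs)"
| "pr_eval g (Comp f fs) xs = pr_eval g f (map (\<lambda>f'. pr_eval g f' xs) fs)"
| "pr_eval g (Rec f f') xs =
     rec_nat (pr_eval g f (tl xs)) (\<lambda>m r. pr_eval g f' (m # r # tl xs)) (hd xs)"

fun oracle_free :: "pr_fun \<Rightarrow> bool" where
  "oracle_free Oracle \<longleftrightarrow> False"
| "oracle_free (Comp f fs) \<longleftrightarrow> oracle_free f \<and> (\<forall>f'\<in>set fs. oracle_free f')"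
| "oracle_free (Rec f f') \<longleftrightarrow> oracle_free f \<and> oracle_free f'"
| "oracle_free _ \<longleftrightarrow> True"

definition primitive_recursive :: "nat \<Rightarrow> (nat list \<Rightarrow> nat) \<Rightarrow> bool" where
  "primitive_recursive k F \<longleftrightarrow>
    (\<exists>f. has_arity f k \<and> oracle_free f \<and> (\<forall>g xs. length xs = k \<longrightarrow> pr_eval g f xs = F xs))"

text \<open>A primitive recursive coding of finite sequences: being a code, length, projection and
  appending an element are primitive recursive.\<close>

definition pr_coding :: "(nat list \<Rightarrow> nat) \<Rightarrow> bool" where
  "pr_coding sq \<longleftrightarrow> inj sq \<and>
    primitive_recursive 1 (\<lambda>xs. if hd xs \<in> range sq then 1 else 0) \<and>
    (\<exists>len. primitive_recursive 1 len \<and> (\<forall>s. len [sq s] = length s)) \<and>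
    (\<exists>prj. primitive_recursive 2 prj \<and> (\<forall>s. \<forall>i<length s. prj [sq s, i] = s ! i)) \<and>
    (\<exists>app. primitive_recursive 2 app \<and> (\<forall>s x. app [sq s, x] = sq (s @ [x])))"


section \<open>Arithmetical formulas with a function variable\<close>

text \<open>The only function variable is \<open>Oracle\<close>. Number variables are de Bruijn indices; the matrix
  is given by a characteristic function applied to the list of all number variables in scope,
  innermost first.\<close>

datatype formula = Matrix pr_fun | Exists formula | Forall formula

fun holds :: "(nat \<Rightarrow> nat) \<Rightarrow> nat list \<Rightarrow> formula \<Rightarrow> bool" where
  "holds g xs (Matrix f) \<longleftrightarrow> pr_eval g f xs \<noteq> 0"
| "holds g xs (Exists \<phi>) \<longleftrightarrow> (\<exists>x. holds g (x # xs) \<phi>)"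
| "holds g xs (Forall \<phi>) \<longleftrightarrow> (\<forall>x. holds g (x # xs) \<phi>)"

text \<open>The number variables in scope are \<open>0, \<dots>, k - 1\<close>; thus \<open>wf_formula 0 \<phi>\<close> means that \<open>\<phi>\<close> has no
  free number variables.\<close>

fun wf_formula :: "nat \<Rightarrow> formula \<Rightarrow> bool" where
  "wf_formula k (Matrix f) \<longleftrightarrow> has_arity f k"
| "wf_formula k (Exists \<phi>) \<longleftrightarrow> wf_formula (Suc k) \<phi>"
| "wf_formula k (Forall \<phi>) \<longleftrightarrow> wf_formula (Suc k) \<phi>"

text \<open>The level counts nonempty blocks of equal quantifiers: a quantifier may either start a new
  block or extend the leading one.\<close>

inductive sigma_formula :: "nat \<Rightarrow> formula \<Rightarrow> bool"
  and pi_formula :: "nat \<Rightarrow> formula \<Rightarrow> bool" where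
  "sigma_formula 0 (Matrix f)"
| "pi_formula 0 (Matrix f)"
| "pi_formula n \<phi> \<Longrightarrow> sigma_formula (Suc n) (Exists \<phi>)"
| "sigma_formula (Suc n) \<phi> \<Longrightarrow> sigma_formula (Suc n) (Exists \<phi>)"
| "sigma_formula n \<phi> \<Longrightarrow> pi_formula (Suc n) (Forall \<phi>)"
| "pi_formula (Suc n) \<phi> \<Longrightarrow> pi_formula (Suc n) (Forall \<phi>)"


section \<open>Representation of hyper-terms by functions\<close>

definition represents ::
  "(nat list \<Rightarrow> nat) \<Rightarrow> ('c \<Rightarrow> nat) \<Rightarrow> (nat \<Rightarrow> nat) \<Rightarrow> 'c hterm \<Rightarrow> bool" where
  "represents sq code h t \<longleftrightarrow> (\<forall>a c. label_at t a = Some c \<longrightarrow> h (sq a) = code c)"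

end

(* Induction on the sequence of bundles, for formulas with an extra variable for the address of a
   subterm. A term belongs to a type of an inductive bundle iff there is a derivation of this fact:
   a finite list of facts (address, type), each of which follows by a construction rule from earlier
   facts in the list or is a true fact about a type of an earlier bundle. The list is coded by a
   number, so the quantifiers over its entries are bounded and the relation stays in the same class.
   Dually, membership in a type of a coinductive bundle is refuted by a finite derivation, because
   the negation of a deconstruction rule is a finite set of finitary rules; this replaces an appeal
   to Koenig's lemma. *)
theory Submission imports Defs begin

section \<open>Functions primitive recursive in the function variable\<close>

text \<open>The class is preserved because n is at least 1: the quantifier over codes of derivations
  merges with the leading \<open>\<exists>\<close> of the relations for earlier types, and the
  bounded universal quantifiers over entries move past that \<open>\<exists>\<close> by coding a
  list of witnesses. The obstacle is that a formula sees only \<open>h\<close> and address codes,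
  while a bundle is a fixed point over sets of hyper-terms. Derivability is therefore defined for
  arbitrary \<open>h\<close> and arbitrary numbers, and compared with the types only where a
  hyper-term is represented. One half of the comparison is rule induction on derivations. The other
  half exhibits a tuple of sets of hyper-terms, defined through derivability, that competes in the
  definition of the fixed point. There are only finitely many rules since constructors and
  identifiers are finite in number and premise indices are bounded by arities. Where the kind of
  bundle changes, the earlier types are available only in the dual class; a dummy quantifier lifts
  them, and this is the increase of the rank by one.\<close>

definition pr_function :: "nat \<Rightarrow> ((nat \<Rightarrow> nat) \<Rightarrow> nat list \<Rightarrow> nat) \<Rightarrow> bool" where
  "pr_function k F \<longleftrightarrow>
    (\<exists>f. has_arity f k \<and> (\<forall>h xs. length xs = k \<longrightarrow> pr_eval h f xs = F h xs))"

lemma pr_functionI: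
  assumes "has_arity f k" "\<And>h xs. length xs = k \<Longrightarrow> pr_eval h f xs = F h xs"
  shows "pr_function k F"
  using assms unfolding pr_function_def by blast

lemma pr_function_cong:
  assumes "pr_function k F" "\<And>h xs. length xs = k \<Longrightarrow> F h xs = G h xs"
  shows "pr_function k G"
  using assms unfolding pr_function_def by metis

lemma pr_function_nth: "i < k \<Longrightarrow> pr_function k (\<lambda>h xs. xs ! i)"
  by (rule pr_functionI[of "Proj i"]) (auto intro: has_arity.intros)

lemma pr_function_comp:
  assumes F: "pr_function (length Gs) F" and Gs: "\<forall>G\<in>set Gs. pr_function k G"
  shows "pr_function k (\<lambda>h xs. F h (map (\<lambda>G. G h xs) Gs))"
proof -
  obtain f where f: "has_arity f (length Gs)"
    "\<And>h xs. length xs = length Gs \<Longrightarrow> pr_eval h f xs = F h xs"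
    using F unfolding pr_function_def by blast
  obtain g where g: "\<And>G. G \<in> set Gs \<Longrightarrow> has_arity (g G) k"
    "\<And>G h xs. G \<in> set Gs \<Longrightarrow> length xs = k \<Longrightarrow> pr_eval h (g G) xs = G h xs"
    using Gs unfolding pr_function_def by metis
  show ?thesis
  proof (rule pr_functionI)
    show "has_arity (Comp f (map g Gs)) k"
      using f(1) g(1) by (auto intro!: has_arity.intros)
    show "pr_eval h (Comp f (map g Gs)) xs = F h (map (\<lambda>G. G h xs) Gs)" if "length xs = k" for h xs
    proof -
      have "map (\<lambda>f'. pr_eval h f' xs) (map g Gs) = map (\<lambda>G. G h xs) Gs"
        using g(2) that by simp
      then show ?thesis using f(2) by (simp del: map_map)
    qed
  qed
qed

lemma pr_function_comp1:
  assumes "pr_function 1 F" "pr_function k G"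
  shows "pr_function k (\<lambda>h xs. F h [G h xs])"
  using pr_function_comp[of "[G]" F k] assms by simp

lemma pr_function_comp2:
  assumes "pr_function 2 F" "pr_function k G" "pr_function k G'"
  shows "pr_function k (\<lambda>h xs. F h [G h xs, G' h xs])"
  using pr_function_comp[of "[G, G']" F k] assms by (simp add: numeral_2_eq_2)

lemma map_nth_length: "length xs = k \<Longrightarrow> map ((!) xs) [0..<k] = xs"
  using map_nth[of xs] by simp

lemma map_nth_Suc: "length xs = Suc k \<Longrightarrow> map ((!) xs) [Suc 0..<Suc k] = tl xs"
  by (cases xs) (auto intro!: nth_equalityI simp del: upt_Suc)

lemma pr_function_tl:
  assumes "pr_function k F"
  shows "pr_function (Suc k) (\<lambda>h xs. F h (tl xs))"
proof -
  have "pr_function (Suc k)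
      (\<lambda>h xs. F h (map (\<lambda>G. G h xs) (map (\<lambda>i h xs. xs ! i) [Suc 0..<Suc k])))"
    by (rule pr_function_comp) (use assms in \<open>auto intro: pr_function_nth simp del: upt_Suc\<close>)
  then show ?thesis
    by (rule pr_function_cong) (simp add: comp_def map_nth_Suc del: upt_Suc)
qed

lemma pr_function_hd: "pr_function (Suc k) (\<lambda>h xs. hd xs)"
  by (rule pr_function_cong[OF pr_function_nth[of 0]]) (auto simp: hd_conv_nth simp flip: length_greater_0_conv)

lemma pr_function_oracle: "pr_function k F \<Longrightarrow> pr_function k (\<lambda>h xs. h (F h xs))"
  using pr_function_comp1[of "\<lambda>h xs. h (hd xs)" k F] pr_functionI[of Oracle 1]
  by (simp add: has_arity.intros flip: One_nat_def)

lemma pr_function_const: "pr_function k (\<lambda>h xs. m)"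
proof (induction m)
  case 0
  show ?case by (rule pr_functionI[of Zero]) (auto intro: has_arity.intros)
next
  case (Suc m)
  then show ?case
    using pr_function_comp1[of "\<lambda>h xs. Suc (hd xs)" k "\<lambda>h xs. m"] pr_functionI[of Succ 1]
    by (simp add: has_arity.intros flip: One_nat_def)
qed

text \<open>\<open>Rec\<close> recurses on its own first argument; composition then puts
  \<open>N\<close> in that place and keeps the parameters.\<close>

lemma pr_function_rec:
  assumes "pr_function k F" "pr_function (k + 2) G" "pr_function k N"
  shows "pr_function k (\<lambda>h xs. rec_nat (F h xs) (\<lambda>m r. G h (m # r # xs)) (N h xs))"
proof -
  obtain f g where fg: "has_arity f k" "has_arity g (k + 2)"
    "\<And>h xs. length xs = k \<Longrightarrow> pr_eval h f xs = F h xs"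
    "\<And>h xs. length xs = k + 2 \<Longrightarrow> pr_eval h g xs = G h xs"
    using assms(1,2) unfolding pr_function_def by blast
  have "pr_function (Suc k) (\<lambda>h xs. rec_nat (F h (tl xs)) (\<lambda>m r. G h (m # r # tl xs)) (hd xs))"
    by (rule pr_functionI[of "Rec f g"]) (use fg has_arity.intros(6)[of f k g] in auto)
  then have "pr_function k (\<lambda>h xs. (\<lambda>h xs. rec_nat (F h (tl xs)) (\<lambda>m r. G h (m # r # tl xs)) (hd xs)) h
      (map (\<lambda>G. G h xs) (N # map (\<lambda>i h xs. xs ! i) [0..<k])))"
    by (intro pr_function_comp) (use assms(3) in \<open>auto intro: pr_function_nth\<close>)
  then show ?thesis
    by (rule pr_function_cong) (auto simp: comp_def map_nth)
qed

lemma pr_function_if: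
  assumes "pr_function k F" "pr_function k G" "pr_function k N"
  shows "pr_function k (\<lambda>h xs. if N h xs = 0 then F h xs else G h xs)"
proof -
  \<comment> \<open>The step function discards both the counter and the previous value, so the
    recursion yields \<open>G\<close> as soon as \<open>N\<close> is positive.\<close>
  have "pr_function (k + 2) (\<lambda>h xs. G h (tl (tl xs)))"
    using pr_function_tl[OF pr_function_tl[OF assms(2)]] by simp
  from pr_function_rec[OF assms(1) this assms(3)] show ?thesis
    by (rule pr_function_cong) (simp split: nat.split add: old.nat.rec(2) gr0_conv_Suc, metis not0_implies_Suc old.nat.simps(7))
qed

lemma pr_function_diff:
  assumes "pr_function k F" "pr_function k G"
  shows "pr_function k (\<lambda>h xs. F h xs - G h xs)"
proof -
  have pred: "pr_function 1 (\<lambda>h xs. hd xs - 1)"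
  proof (rule pr_function_cong)
    show "pr_function 1 (\<lambda>h xs. rec_nat 0 (\<lambda>m r. (m # r # xs) ! 0) (xs ! 0))"
      by (intro pr_function_rec pr_function_const pr_function_nth) auto
    show "rec_nat 0 (\<lambda>m r. (m # r # xs) ! 0) (xs ! 0) = hd xs - 1" if "length xs = 1" for xs :: "nat list"
      using that by (cases "xs ! 0") (auto simp: hd_conv_nth length_Suc_conv)
  qed
  have "pr_function (k + 2) (\<lambda>h xs. (\<lambda>h xs. hd xs - 1) h [xs ! 1])"
    by (intro pr_function_comp1[OF pred] pr_function_nth) simp
  from pr_function_rec[OF assms(1) this assms(2)] show ?thesis
  proof (rule pr_function_cong)
    fix h xs
    have "rec_nat a (\<lambda>m r. r - 1) b = a - b" for a b :: nat
      by (induction b) auto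
    then show "rec_nat (F h xs) (\<lambda>m r. hd [(m # r # xs) ! 1] - 1) (G h xs) = F h xs - G h xs"
      by simp
  qed
qed

section \<open>Arithmetical relations\<close>

text \<open>Only blocks of length one are used, and \<open>\<Pi>\<^sub>n\<close> relations are treated as complements of
  \<open>\<Sigma>\<^sub>n\<close> relations; so one recursion covers both hierarchies.\<close>

fun sigma_rel :: "nat \<Rightarrow> nat \<Rightarrow> ((nat \<Rightarrow> nat) \<Rightarrow> nat list \<Rightarrow> bool) \<Rightarrow> bool" where
  "sigma_rel 0 k P \<longleftrightarrow>
    (\<exists>F. pr_function k F \<and> (\<forall>h xs. length xs = k \<longrightarrow> (P h xs \<longleftrightarrow> F h xs \<noteq> 0)))"
| "sigma_rel (Suc n) k P \<longleftrightarrow>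
    (\<exists>Q. sigma_rel n (Suc k) Q \<and> (\<forall>h xs. length xs = k \<longrightarrow> (P h xs \<longleftrightarrow> (\<exists>x. \<not> Q h (x # xs)))))"

declare sigma_rel.simps [simp del]

lemma sigma_rel_0I:
  assumes "pr_function k F" "\<And>h xs. length xs = k \<Longrightarrow> P h xs \<longleftrightarrow> F h xs \<noteq> 0"
  shows "sigma_rel 0 k P"
  using assms unfolding sigma_rel.simps by blast

lemma sigma_rel_SucI:
  assumes "sigma_rel n (Suc k) Q" "\<And>h xs. length xs = k \<Longrightarrow> P h xs \<longleftrightarrow> (\<exists>x. \<not> Q h (x # xs))"
  shows "sigma_rel (Suc n) k P"
  using assms unfolding sigma_rel.simps by blast

text \<open>\<open>sigma_rel\<close> constrains a relation only at lists of length \<open>k\<close>;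
  its values elsewhere may be changed freely.\<close>

lemma sigma_rel_cong:
  assumes "sigma_rel n k P" "\<And>h xs. length xs = k \<Longrightarrow> P h xs \<longleftrightarrow> Q h xs"
  shows "sigma_rel n k Q"
proof (cases n)
  case 0
  with assms(1) obtain F where "pr_function k F" "\<And>h xs. length xs = k \<Longrightarrow> P h xs \<longleftrightarrow> F h xs \<noteq> 0"
    unfolding 0 sigma_rel.simps by blast
  with assms(2) show ?thesis unfolding 0 by (intro sigma_rel_0I) auto
next
  case (Suc m)
  from assms(1)[unfolded Suc] obtain R where "sigma_rel m (Suc k) R"
    "\<And>h xs. length xs = k \<Longrightarrow> P h xs \<longleftrightarrow> (\<exists>x. \<not> R h (x # xs))" unfolding sigma_rel.simps by blast
  with assms(2) show ?thesis unfolding Suc by (intro sigma_rel_SucI) auto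
qed

lemma sigma_rel_subst:
  assumes "sigma_rel n (length Gs) P" "\<forall>G\<in>set Gs. pr_function k G"
  shows "sigma_rel n k (\<lambda>h xs. P h (map (\<lambda>G. G h xs) Gs))"
  using assms
proof (induction n arbitrary: k Gs P)
  case 0
  from 0(1) obtain F where F: "pr_function (length Gs) F"
    "\<And>h xs. length xs = length Gs \<Longrightarrow> P h xs \<longleftrightarrow> F h xs \<noteq> 0" unfolding sigma_rel.simps by blast
  show ?case
    by (rule sigma_rel_0I[OF pr_function_comp[OF F(1) 0(2)]]) (simp add: F(2))
next
  case (Suc n)
  from Suc.prems(1) obtain Q where Q: "sigma_rel n (Suc (length Gs)) Q"
    "\<And>h xs. length xs = length Gs \<Longrightarrow> P h xs \<longleftrightarrow> (\<exists>x. \<not> Q h (x # xs))" unfolding sigma_rel.simps by blast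
  \<comment> \<open>The variable quantified by \<open>Q\<close> stays at the head and is passed on
    unchanged; the substituted functions see only the tail.\<close>
  let ?Gs = "(\<lambda>h xs. hd xs) # map (\<lambda>G h xs. G h (tl xs)) Gs"
  have "sigma_rel n (Suc k) (\<lambda>h xs. Q h (map (\<lambda>G. G h xs) ?Gs))"
    by (rule Suc.IH) (use Q(1) Suc.prems(2) in \<open>auto intro: pr_function_hd pr_function_tl\<close>)
  then show ?case
    by (rule sigma_rel_SucI) (simp add: Q(2) comp_def)
qed

lemma sigma_rel_subst1:
  assumes "sigma_rel n 1 P" "pr_function k G"
  shows "sigma_rel n k (\<lambda>h xs. P h [G h xs])"
  using sigma_rel_subst[of n "[G]" P k] assms by simp

lemma sigma_rel_tl: 
  assumes "sigma_rel n k P"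
  shows "sigma_rel n (Suc k) (\<lambda>h xs. P h (tl xs))"
proof -
  have "sigma_rel n (Suc k)
      (\<lambda>h xs. P h (map (\<lambda>G. G h xs) (map (\<lambda>i h xs. xs ! i) [Suc 0..<Suc k])))"
    by (rule sigma_rel_subst) (use assms in \<open>auto intro: pr_function_nth simp del: upt_Suc\<close>)
  then show ?thesis
    by (rule sigma_rel_cong) (simp add: comp_def map_nth_Suc del: upt_Suc)
qed

text \<open>The new quantifier is a dummy: the matrix ignores its variable.\<close>

lemma sigma_rel_neg_Suc:
  assumes "sigma_rel n k P"
  shows "sigma_rel (Suc n) k (\<lambda>h xs. \<not> P h xs)"
  using sigma_rel_tl[OF assms] by (rule sigma_rel_SucI) simp

lemma sigma_rel_0_neg:
  assumes "sigma_rel 0 k P"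
  shows "sigma_rel 0 k (\<lambda>h xs. \<not> P h xs)"
proof -
  obtain F where F: "pr_function k F" "\<And>h xs. length xs = k \<Longrightarrow> P h xs \<longleftrightarrow> F h xs \<noteq> 0"
    using assms unfolding sigma_rel.simps by blast
  have "pr_function k (\<lambda>h xs. if F h xs = 0 then 1 else 0)"
    by (intro pr_function_if F pr_function_const)
  then show ?thesis by (rule sigma_rel_0I) (simp add: F(2))
qed

text \<open>The dummy quantifier is inserted innermost, at level 0, where complements are free; the
  quantifiers in front of it keep their pattern.\<close>

lemma sigma_rel_Suc:
  assumes "sigma_rel n k P"
  shows "sigma_rel (Suc n) k P"
  using assms
proof (induction n arbitrary: k P)
  case 0
  from sigma_rel_neg_Suc[OF sigma_rel_0_neg[OF this]] show ?case by simp
next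
  case (Suc n)
  from Suc.prems obtain Q where Q: "sigma_rel n (Suc k) Q"
    "\<And>h xs. length xs = k \<Longrightarrow> P h xs \<longleftrightarrow> (\<exists>x. \<not> Q h (x # xs))" unfolding sigma_rel.simps by blast
  show ?case by (rule sigma_rel_SucI[OF Suc.IH[OF Q(1)] Q(2)])
qed

lemma sigma_rel_0_imp: "sigma_rel 0 k P \<Longrightarrow> sigma_rel n k P"
  by (induction n) (auto intro: sigma_rel_Suc)

lemma sigma_rel_const: "sigma_rel n k (\<lambda>h xs. b)"
  by (rule sigma_rel_0_imp)
    (rule sigma_rel_0I[OF pr_function_const[of k "if b then 1 else 0"]], simp)

lemma sigma_rel_0_conj:
  assumes "sigma_rel 0 k P" "sigma_rel 0 k Q"
  shows "sigma_rel 0 k (\<lambda>h xs. P h xs \<and> Q h xs)"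
proof -
  obtain F where F: "pr_function k F" "\<And>h xs. length xs = k \<Longrightarrow> P h xs \<longleftrightarrow> F h xs \<noteq> 0"
    using assms(1) unfolding sigma_rel.simps by blast
  obtain G where G: "pr_function k G" "\<And>h xs. length xs = k \<Longrightarrow> Q h xs \<longleftrightarrow> G h xs \<noteq> 0"
    using assms(2) unfolding sigma_rel.simps by blast
  have "pr_function k (\<lambda>h xs. if F h xs = 0 then 0 else G h xs)"
    by (intro pr_function_if F G pr_function_const)
  then show ?thesis by (rule sigma_rel_0I) (simp add: F(2) G(2))
qed

lemma sigma_rel_0_disj:
  assumes "sigma_rel 0 k P" "sigma_rel 0 k Q"
  shows "sigma_rel 0 k (\<lambda>h xs. P h xs \<or> Q h xs)"
  using sigma_rel_0_neg[OF sigma_rel_0_conj[OF sigma_rel_0_neg[OF assms(1)] sigma_rel_0_neg[OF assms(2)]]]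
  by simp

lemma sigma_rel_less:
  assumes "pr_function k F" "pr_function k G"
  shows "sigma_rel n k (\<lambda>h xs. F h xs < G h xs)"
  by (rule sigma_rel_0_imp)
    (rule sigma_rel_0I[OF pr_function_diff[OF assms(2,1)]], auto)

lemma sigma_rel_eq:
  assumes "pr_function k F" "pr_function k G"
  shows "sigma_rel n k (\<lambda>h xs. F h xs = G h xs)"
proof (rule sigma_rel_0_imp)
  have "sigma_rel 0 k (\<lambda>h xs. \<not> (F h xs < G h xs) \<and> \<not> (G h xs < F h xs))"
    by (intro sigma_rel_0_conj sigma_rel_0_neg sigma_rel_less assms)
  then show "sigma_rel 0 k (\<lambda>h xs. F h xs = G h xs)"
    by (rule sigma_rel_cong) auto
qed

lemma sigma_rel_0_ball:
  assumes "sigma_rel 0 (Suc k) P" "pr_function k B"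
  shows "sigma_rel 0 k (\<lambda>h xs. \<forall>i<B h xs. P h (i # xs))"
proof -
  obtain F where F: "pr_function (Suc k) F" "\<And>h xs. length xs = Suc k \<Longrightarrow> P h xs \<longleftrightarrow> F h xs \<noteq> 0"
    using assms(1) unfolding sigma_rel.simps by blast
  have "pr_function (Suc (Suc k)) (\<lambda>h xs. F h (map (\<lambda>G. G h xs)
      ((\<lambda>h xs. hd xs) # map (\<lambda>i h xs. tl (tl xs) ! i) [0..<k])))"
    by (rule pr_function_comp)
      (use F(1) in \<open>auto intro!: pr_function_hd pr_function_tl pr_function_tl[where F="\<lambda>h xs. tl xs ! i" for i] pr_function_nth\<close>)
  then have "pr_function (Suc (Suc k)) (\<lambda>h xs. F h (hd xs # tl (tl xs)))"
    by (rule pr_function_cong) (simp add: comp_def map_nth_length)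
  \<comment> \<open>Entry 1 is the truth value accumulated so far: it starts at 1, and once it is 0
    it stays 0.\<close>
  then have "pr_function (k + 2) (\<lambda>h xs. if xs ! 1 = 0 then 0 else F h (hd xs # tl (tl xs)))"
    by (intro pr_function_if pr_function_const pr_function_nth) auto
  from pr_function_rec[OF pr_function_const[of k 1] this assms(2)]
  have *: "pr_function k (\<lambda>h xs. rec_nat 1
      (\<lambda>m r. if r = 0 then 0 else F h (m # xs)) (B h xs))"
    by (simp cong: if_cong)
  have "rec_nat 1 (\<lambda>m r. if r = 0 then 0 else F h (m # xs)) b \<noteq> 0 \<longleftrightarrow> (\<forall>i<b. F h (i # xs) \<noteq> 0)"
    for h xs b
    by (induction b) (auto simp: less_Suc_eq)
  with F(2) show ?thesis by (intro sigma_rel_0I[OF *]) simp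
qed

lemma sigma_rel_0_bex:
  assumes "sigma_rel 0 (Suc k) P" "pr_function k B"
  shows "sigma_rel 0 k (\<lambda>h xs. \<exists>i<B h xs. P h (i # xs))"
  using sigma_rel_0_neg[OF sigma_rel_0_ball[OF sigma_rel_0_neg[OF assms(1)] assms(2)]] by simp

text \<open>Both halves go through one induction, since the \<open>\<exists>\<close> formula for
  \<open>P\<close> is built on the pi formula for the complement of \<open>Q\<close>, and the
  \<open>\<forall>\<close> formula for the complement of \<open>P\<close> on the sigma formula for
  \<open>Q\<close>.\<close>

lemma sigma_rel_formulas:
  assumes "sigma_rel n k P"
  shows "(\<exists>\<phi>. sigma_formula n \<phi> \<and> wf_formula k \<phi> \<and> (\<forall>h xs. length xs = k \<longrightarrow> (holds h xs \<phi> \<longleftrightarrow> P h xs))) \<and>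
    (\<exists>\<phi>. pi_formula n \<phi> \<and> wf_formula k \<phi> \<and> (\<forall>h xs. length xs = k \<longrightarrow> (holds h xs \<phi> \<longleftrightarrow> \<not> P h xs)))"
  using assms
proof (induction n arbitrary: k P)
  case 0
  have *: "\<exists>f. has_arity f k \<and> (\<forall>h xs. length xs = k \<longrightarrow> (pr_eval h f xs \<noteq> 0 \<longleftrightarrow> Q h xs))"
    if "sigma_rel 0 k Q" for Q
    using that unfolding sigma_rel.simps pr_function_def by metis
  from *[OF 0] *[OF sigma_rel_0_neg[OF 0]] show ?case
    by (metis holds.simps(1) sigma_formula_pi_formula.intros(1,2) wf_formula.simps(1))
next
  case (Suc n)
  from Suc.prems(1) obtain Q where Q: "sigma_rel n (Suc k) Q"
    "\<And>h xs. length xs = k \<Longrightarrow> P h xs \<longleftrightarrow> (\<exists>x. \<not> Q h (x # xs))" unfolding sigma_rel.simps by blast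
  from Suc.IH[OF Q(1)] obtain \<phi> \<psi> where
    "sigma_formula n \<phi>" "wf_formula (Suc k) \<phi>" "\<And>h xs. length xs = Suc k \<Longrightarrow> holds h xs \<phi> \<longleftrightarrow> Q h xs"
    "pi_formula n \<psi>" "wf_formula (Suc k) \<psi>" "\<And>h xs. length xs = Suc k \<Longrightarrow> holds h xs \<psi> \<longleftrightarrow> \<not> Q h xs"
    by blast
  then show ?case
    using Q(2)
    by (intro conjI exI[of _ "Exists \<psi>"] exI[of _ "Forall \<phi>"]) (auto intro: sigma_formula_pi_formula.intros)
qed

section \<open>Closure properties that rest on coded sequences: contraction of quantifiers and
  bounded quantification\<close>

locale sequence_coding =
  fixes sq :: "nat list \<Rightarrow> nat" and len prj app :: "nat list \<Rightarrow> nat"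
  assumes pr_len: "primitive_recursive 1 len" and len: "len [sq s] = length s"
    and pr_prj: "primitive_recursive 2 prj" and prj: "i < length s \<Longrightarrow> prj [sq s, i] = s ! i"
    and pr_app: "primitive_recursive 2 app" and app: "app [sq s, x] = sq (s @ [x])"
begin

lemma pr_function_len: "pr_function k F \<Longrightarrow> pr_function k (\<lambda>h xs. len [F h xs])"
  using pr_len pr_function_comp1[of "\<lambda>h. len"] unfolding primitive_recursive_def pr_function_def by blast

lemma pr_function_prj:
  "pr_function k F \<Longrightarrow> pr_function k G \<Longrightarrow> pr_function k (\<lambda>h xs. prj [F h xs, G h xs])"
  using pr_prj pr_function_comp2[of "\<lambda>h. prj" k F G] unfolding primitive_recursive_def pr_function_def[of 2]
  by blast

lemma pr_function_app:
  "pr_function k F \<Longrightarrow> pr_function k G \<Longrightarrow> pr_function k (\<lambda>h xs. app [F h xs, G h xs])"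
  using pr_app pr_function_comp2[of "\<lambda>h. app" k F G] unfolding primitive_recursive_def pr_function_def[of 2]
  by blast

lemma prj_pair: "prj [sq [x, y], 0] = x" "prj [sq [x, y], Suc 0] = y"
  using prj[of 0 "[x, y]"] prj[of 1 "[x, y]"] by auto

lemma sigma_rel_subst_hd:
  assumes "sigma_rel n (Suc k) P" "pr_function (Suc k) F"
  shows "sigma_rel n (Suc k) (\<lambda>h xs. P h (F h xs # tl xs))"
proof -
  have "sigma_rel n (Suc k)
      (\<lambda>h xs. P h (map (\<lambda>G. G h xs) (F # map (\<lambda>i h xs. xs ! i) [Suc 0..<Suc k])))"
    by (rule sigma_rel_subst) (use assms in \<open>auto intro: pr_function_nth simp del: upt_Suc\<close>)
  then show ?thesis
    by (rule sigma_rel_cong) (simp add: comp_def map_nth_Suc del: upt_Suc)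
qed

lemma sigma_rel_subst_hd2:
  assumes "sigma_rel n (Suc (Suc k)) P" "pr_function (Suc k) F" "pr_function (Suc k) G"
  shows "sigma_rel n (Suc k) (\<lambda>h xs. P h (F h xs # G h xs # tl xs))"
proof -
  have "sigma_rel n (Suc k)
      (\<lambda>h xs. P h (map (\<lambda>G. G h xs) (F # G # map (\<lambda>i h xs. xs ! i) [Suc 0..<Suc k])))"
    by (rule sigma_rel_subst) (use assms in \<open>auto intro: pr_function_nth simp del: upt_Suc\<close>)
  then show ?thesis
    by (rule sigma_rel_cong) (simp add: comp_def map_nth_Suc del: upt_Suc)
qed

text \<open>The leading block absorbs a further \<open>\<exists>\<close>: a single number codes the
  pair of witnesses, so the number of alternations does not grow.\<close>

lemma sigma_rel_ex:
  assumes "sigma_rel (Suc n) (Suc k) (\<lambda>h xs. P h (hd xs) (tl xs))"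
  shows "sigma_rel (Suc n) k (\<lambda>h xs. \<exists>x. P h x xs)"
proof -
  obtain Q where Q: "sigma_rel n (Suc (Suc k)) Q"
    "\<And>h xs. length xs = Suc k \<Longrightarrow> P h (hd xs) (tl xs) \<longleftrightarrow> (\<exists>x. \<not> Q h (x # xs))"
    using assms unfolding sigma_rel.simps by blast
  have 1: "sigma_rel n (Suc k) (\<lambda>h xs. Q h (prj [hd xs, 0] # prj [hd xs, 1] # tl xs))"
    by (intro sigma_rel_subst_hd2 Q(1) pr_function_prj pr_function_hd pr_function_const)
  show ?thesis
  proof (rule sigma_rel_SucI[OF 1])
    fix h and xs :: "nat list"
    assume "length xs = k"
    then have P: "P h x xs \<longleftrightarrow> (\<exists>y. \<not> Q h (y # x # xs))" for x
      using Q(2)[of "x # xs" h] by simp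
    show "(\<exists>x. P h x xs) \<longleftrightarrow>
      (\<exists>p. \<not> Q h (prj [hd (p # xs), 0] # prj [hd (p # xs), 1] # tl (p # xs)))"
    proof
      assume "\<exists>x. P h x xs"
      then obtain x y where "\<not> Q h (y # x # xs)" using P by blast
      then show "\<exists>p. \<not> Q h (prj [hd (p # xs), 0] # prj [hd (p # xs), 1] # tl (p # xs))"
        by (intro exI[of _ "sq [y, x]"]) (simp add: prj_pair)
    \<comment> \<open>Conversely every \<open>p\<close>, a code or not, supplies two numbers through
      \<open>prj\<close>.\<close>
    qed (use P in auto)
  qed
qed

text \<open>Negation in front of the matrix exchanges the two connectives, so each at level
  \<open>Suc n\<close> needs the other at level \<open>n\<close>.\<close>

lemma sigma_rel_conj_disj:
  assumes "sigma_rel n k P" "sigma_rel n k Q"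
  shows "sigma_rel n k (\<lambda>h xs. P h xs \<and> Q h xs) \<and> sigma_rel n k (\<lambda>h xs. P h xs \<or> Q h xs)"
  using assms
proof (induction n arbitrary: k P Q)
  case 0
  then show ?case using sigma_rel_0_conj sigma_rel_0_disj by blast
next
  case (Suc n)
  obtain P' where P': "sigma_rel n (Suc k) P'"
    "\<And>h xs. length xs = k \<Longrightarrow> P h xs \<longleftrightarrow> (\<exists>x. \<not> P' h (x # xs))"
    using Suc.prems(1) unfolding sigma_rel.simps by blast
  obtain Q' where Q': "sigma_rel n (Suc k) Q'"
    "\<And>h xs. length xs = k \<Longrightarrow> Q h xs \<longleftrightarrow> (\<exists>x. \<not> Q' h (x # xs))"
    using Suc.prems(2) unfolding sigma_rel.simps by blast
  \<comment> \<open>Both matrices read their witness from the same number, so that a conjunction of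
    two \<open>\<exists>\<close> becomes one \<open>\<exists>\<close>.\<close>
  let ?P = "\<lambda>h xs. P' h (prj [hd xs, 0] # tl xs)" and ?Q = "\<lambda>h xs. Q' h (prj [hd xs, 1] # tl xs)"
  have PQ: "sigma_rel n (Suc k) ?P" "sigma_rel n (Suc k) ?Q"
    by (intro sigma_rel_subst_hd P'(1) Q'(1) pr_function_prj pr_function_hd pr_function_const)+
  have P: "P h xs \<longleftrightarrow> (\<exists>x. \<not> ?P h (x # xs))" and Q: "Q h xs \<longleftrightarrow> (\<exists>x. \<not> ?Q h (x # xs))"
    and PQ': "P h xs \<Longrightarrow> Q h xs \<Longrightarrow> \<exists>x. \<not> ?P h (x # xs) \<and> \<not> ?Q h (x # xs)"
    if "length xs = k" for h xs
  proof -
    have 1: "\<exists>p. \<not> ?P h (p # xs) \<and> \<not> ?Q h (p # xs)"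
      if "\<not> P' h (x # xs)" "\<not> Q' h (y # xs)" for x y
      using that by (intro exI[of _ "sq [x, y]"]) (simp add: prj_pair)
    have 2: "\<exists>p. \<not> ?P h (p # xs)" if "\<not> P' h (x # xs)" for x
      using that by (intro exI[of _ "sq [x, x]"]) (simp add: prj_pair)
    have 3: "\<exists>p. \<not> ?Q h (p # xs)" if "\<not> Q' h (y # xs)" for y
      using that by (intro exI[of _ "sq [y, y]"]) (simp add: prj_pair)
    show "P h xs \<longleftrightarrow> (\<exists>x. \<not> ?P h (x # xs))"
      unfolding P'(2)[OF that] using 2 by auto
    show "Q h xs \<longleftrightarrow> (\<exists>x. \<not> ?Q h (x # xs))"
      unfolding Q'(2)[OF that] using 3 by auto
    show "\<exists>x. \<not> ?P h (x # xs) \<and> \<not> ?Q h (x # xs)" if "P h xs" "Q h xs"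
      using that 1 unfolding P'(2)[OF \<open>length xs = k\<close>] Q'(2)[OF \<open>length xs = k\<close>] by blast
  qed
  show ?case
  proof
    show "sigma_rel (Suc n) k (\<lambda>h xs. P h xs \<and> Q h xs)"
      by (rule sigma_rel_SucI[OF conjunct2[OF Suc.IH[OF PQ]]]) (use P Q PQ' in blast)
    show "sigma_rel (Suc n) k (\<lambda>h xs. P h xs \<or> Q h xs)"
      by (rule sigma_rel_SucI[OF conjunct1[OF Suc.IH[OF PQ]]]) (use P Q in blast)
  qed
qed

lemma sigma_rel_conj:
  "sigma_rel n k P \<Longrightarrow> sigma_rel n k Q \<Longrightarrow> sigma_rel n k (\<lambda>h xs. P h xs \<and> Q h xs)"
  and sigma_rel_disj:
  "sigma_rel n k P \<Longrightarrow> sigma_rel n k Q \<Longrightarrow> sigma_rel n k (\<lambda>h xs. P h xs \<or> Q h xs)"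
  using sigma_rel_conj_disj by blast+

lemma sigma_rel_finite_bex:
  assumes "finite I" "\<And>x. x \<in> I \<Longrightarrow> sigma_rel n k (P x)"
  shows "sigma_rel n k (\<lambda>h xs. \<exists>x\<in>I. P x h xs)"
  using assms by (induction I) (auto intro: sigma_rel_const sigma_rel_disj)

lemma sigma_rel_finite_ball:
  assumes "finite I" "\<And>x. x \<in> I \<Longrightarrow> sigma_rel n k (P x)"
  shows "sigma_rel n k (\<lambda>h xs. \<forall>x\<in>I. P x h xs)"
  using assms by (induction I) (auto intro: sigma_rel_const sigma_rel_conj)

text \<open>A bounded \<open>\<forall>\<close> in front of \<open>\<exists>\<close> is turned into
  \<open>\<exists>\<close> of a coded list of witnesses; after the negation a bounded
  \<open>\<exists>\<close> is left at the level below, which is why both claims are proved together.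
  A bounded \<open>\<exists>\<close> is an ordinary one with the bound as a conjunct.\<close>

lemma sigma_rel_bounded:
  assumes "sigma_rel n (Suc k) P" "pr_function k B"
  shows "sigma_rel n k (\<lambda>h xs. \<forall>i<B h xs. P h (i # xs)) \<and>
    sigma_rel n k (\<lambda>h xs. \<exists>i<B h xs. P h (i # xs))"
  using assms
proof (induction n arbitrary: k P B)
  case 0
  then show ?case using sigma_rel_0_ball sigma_rel_0_bex by blast
next
  case (Suc n)
  obtain Q where Q: "sigma_rel n (Suc (Suc k)) Q"
    "\<And>h xs. length xs = Suc k \<Longrightarrow> P h xs \<longleftrightarrow> (\<exists>x. \<not> Q h (x # xs))"
    using Suc.prems(1) unfolding sigma_rel.simps by blast
  \<comment> \<open>The arguments here are the index, the coded list of witnesses and the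
    parameters; \<open>Q\<close> receives the witness for that index, the index and the
    parameters.\<close>
  have "sigma_rel n (Suc (Suc k)) (\<lambda>h xs. Q h (map (\<lambda>G. G h xs)
      ((\<lambda>h xs. prj [tl xs ! 0, hd xs]) # (\<lambda>h xs. hd xs) # map (\<lambda>i h xs. tl (tl xs) ! i) [0..<k])))"
    by (rule sigma_rel_subst)
      (use Q(1) in \<open>auto intro!: pr_function_prj pr_function_hd pr_function_tl
        pr_function_tl[where F="\<lambda>h xs. tl xs ! i" for i] pr_function_tl[where F="\<lambda>h xs. xs ! i" for i] pr_function_nth\<close>)
  then have "sigma_rel n (Suc (Suc k)) (\<lambda>h xs. Q h (prj [tl xs ! 0, hd xs] # hd xs # tl (tl xs)))"
    by (rule sigma_rel_cong) (simp add: comp_def map_nth_length)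
  from conjunct2[OF Suc.IH[OF this pr_function_tl[OF Suc.prems(2)]]]
  have 1: "sigma_rel n (Suc k) (\<lambda>h xs. \<exists>i<B h (tl xs). Q h (prj [hd xs, i] # i # tl xs))"
    by (rule sigma_rel_cong) (auto simp: length_Suc_conv)
  have ball: "sigma_rel (Suc n) k (\<lambda>h xs. \<forall>i<B h xs. P h (i # xs))"
  proof (rule sigma_rel_SucI[OF 1], unfold list.sel)
    fix h and xs :: "nat list"
    assume "length xs = k"
    then have P: "P h (i # xs) \<longleftrightarrow> (\<exists>x. \<not> Q h (x # i # xs))" for i
      using Q(2)[of "i # xs" h] by simp
    show "(\<forall>i<B h xs. P h (i # xs)) \<longleftrightarrow> (\<exists>s. \<not> (\<exists>i<B h xs. Q h (prj [s, i] # i # xs)))"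
    proof
      assume *: "\<forall>i<B h xs. P h (i # xs)"
      define f where "f i = (SOME x. \<not> Q h (x # i # xs))" for i
      have f: "\<not> Q h (f i # i # xs)" if "i < B h xs" for i
        using * that someI_ex[of "\<lambda>x. \<not> Q h (x # i # xs)"] unfolding f_def P by blast
      have "prj [sq (map f [0..<B h xs]), i] = f i" if "i < B h xs" for i
        using prj[of i "map f [0..<B h xs]"] that by simp
      then have "\<not> (\<exists>i<B h xs. Q h (prj [sq (map f [0..<B h xs]), i] # i # xs))"
        using f by metis
      then show "\<exists>s. \<not> (\<exists>i<B h xs. Q h (prj [s, i] # i # xs))" by (rule exI)
    next
      assume "\<exists>s. \<not> (\<exists>i<B h xs. Q h (prj [s, i] # i # xs))"
      then show "\<forall>i<B h xs. P h (i # xs)" unfolding P by blast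
    qed
  qed
  have "sigma_rel (Suc n) (Suc k) (\<lambda>h xs. P h (hd xs # tl xs))"
    by (rule sigma_rel_cong[OF Suc.prems(1)]) (auto simp: length_Suc_conv)
  then have "sigma_rel (Suc n) (Suc k) (\<lambda>h xs. hd xs < B h (tl xs) \<and> P h (hd xs # tl xs))"
    by (intro sigma_rel_conj sigma_rel_less pr_function_hd pr_function_tl Suc.prems(2))
  from sigma_rel_ex[OF this] ball show ?case by (intro conjI)
qed

text \<open>Keeping the bound variable as a separate argument lets the nested quantifiers of
  \<open>coded_derivation\<close> be peeled off one by one with \<open>intro\<close>.\<close>

lemma sigma_rel_bounded_all:
  assumes "sigma_rel n (Suc k) (\<lambda>h xs. P h (hd xs) (tl xs))" "pr_function k B"
  shows "sigma_rel n k (\<lambda>h xs. \<forall>i<B h xs. P h i xs)"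
  using sigma_rel_bounded[OF assms] by simp

lemma sigma_rel_bounded_ex:
  assumes "sigma_rel n (Suc k) (\<lambda>h xs. P h (hd xs) (tl xs))" "pr_function k B"
  shows "sigma_rel n k (\<lambda>h xs. \<exists>i<B h xs. P h i xs)"
  using sigma_rel_bounded[OF assms] by simp

end

section \<open>Finitary derivations\<close>

text \<open>A fact is a pair of an address code and an identifier. In a rule \<open>(D, c, N)\<close>, an element \<open>(j, D')\<close>
  of \<open>N\<close> is the premise that \<open>D'\<close> holds at the child with index \<open>j\<close>.\<close>

locale derivations = sequence_coding sq len prj app
  for sq :: "nat list \<Rightarrow> nat" and len prj app :: "nat list \<Rightarrow> nat" +
  fixes code :: "'c \<Rightarrow> nat" and E :: "'d set" and P :: "'d \<Rightarrow> (nat \<Rightarrow> nat) \<Rightarrow> nat list \<Rightarrow> bool"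
    and Rs :: "('d \<times> 'c \<times> (nat \<times> 'd) set) set"
  assumes finite_E: "finite E" and finite_Rs: "finite Rs"
    and finite_premises: "(D, c, N) \<in> Rs \<Longrightarrow> finite N"
begin

text \<open>No hyper-term is mentioned, so the notion makes sense for every \<open>h\<close> and
  every number \<open>a\<close>. It will mean membership for an inductive bundle and non-membership
  for a coinductive one; \<open>E\<close> and \<open>P\<close> supply the earlier types,
  complemented in the second case.\<close>

inductive derivable :: "(nat \<Rightarrow> nat) \<Rightarrow> nat \<Rightarrow> 'd \<Rightarrow> bool" for h where
  axiom: "D \<in> E \<Longrightarrow> P D h [a] \<Longrightarrow> derivable h a D"
| step: "(D, c, N) \<in> Rs \<Longrightarrow> h a = code c \<Longrightarrow>
    (\<And>j D'. (j, D') \<in> N \<Longrightarrow> derivable h (app [a, j]) D') \<Longrightarrow> derivable h a D"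

definition justified :: "(nat \<Rightarrow> nat) \<Rightarrow> (nat \<times> 'd) set \<Rightarrow> nat \<times> 'd \<Rightarrow> bool" where
  "justified h S = (\<lambda>(a, D). D \<in> E \<and> P D h [a] \<or>
    (\<exists>c N. (D, c, N) \<in> Rs \<and> h a = code c \<and> (\<forall>(j, D')\<in>N. (app [a, j], D') \<in> S)))"

definition derivation :: "(nat \<Rightarrow> nat) \<Rightarrow> (nat \<times> 'd) list \<Rightarrow> bool" where
  "derivation h L \<longleftrightarrow> (\<forall>i<length L. justified h (set (take i L)) (L ! i))"

lemma justified_mono: "justified h S f \<Longrightarrow> S \<subseteq> S' \<Longrightarrow> justified h S' f"
  unfolding justified_def by (cases f) fast

text \<open>Entries of the second list keep their justifications, because a larger set of earlier
  facts justifies at least as much.\<close>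

lemma derivation_append:
  assumes "derivation h L" "derivation h L'"
  shows "derivation h (L @ L')"
  unfolding derivation_def
proof (intro allI impI)
  fix i assume i: "i < length (L @ L')"
  show "justified h (set (take i (L @ L'))) ((L @ L') ! i)"
  proof (cases "i < length L")
    case True
    then show ?thesis using assms(1) by (simp add: derivation_def nth_append)
  next
    case False
    then have "justified h (set (take (i - length L) L')) (L' ! (i - length L))"
      using assms(2) i by (simp add: derivation_def)
    then show ?thesis using False by (auto simp: nth_append elim: justified_mono)
  qed
qed

lemma derivation_snoc:
  assumes "derivation h L" "justified h (set L) f"
  shows "derivation h (L @ [f])"
  using assms by (auto simp: derivation_def nth_append less_Suc_eq)

text \<open>Each rule has finitely many premises, so the derivations of the premises can be
  concatenated into one finite list, to which the conclusion is added.\<close>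

lemma derivation_exists:
  assumes "derivable h a D"
  shows "\<exists>L. derivation h L \<and> (a, D) \<in> set L"
  using assms
proof induction
  case (axiom D a)
  then have "derivation h [(a, D)]" by (simp add: derivation_def justified_def)
  then show ?case by (intro exI[of _ "[(a, D)]"]) simp
next
  case (step D c N a)
  have "\<exists>L. derivation h L \<and> (\<forall>(j, D')\<in>M. (app [a, j], D') \<in> set L)" if "finite M" "M \<subseteq> N" for M
    using that
  proof (induction M)
    case empty
    have "derivation h []" by (simp add: derivation_def)
    then show ?case by blast
  next
    case (insert p M)
    from insert.IH insert.prems obtain L where
      L: "derivation h L" "\<forall>(j, D')\<in>M. (app [a, j], D') \<in> set L"
      unfolding insert_subset by metis
    obtain j D' where p: "p = (j, D')" by (cases p)
    then have "(j, D') \<in> N" using insert.prems by simp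
    from step.IH[OF this] obtain L' where L': "derivation h L'" "(app [a, j], D') \<in> set L'"
      by blast
    have "\<forall>(j, D')\<in>insert p M. (app [a, j], D') \<in> set (L @ L')"
      using L(2) L'(2) p by auto
    with derivation_append[OF L(1) L'(1)] show ?case by blast
  qed
  from this[OF finite_premises[OF step.hyps(1)] subset_refl] obtain L where
    L: "derivation h L" "\<forall>(j, D')\<in>N. (app [a, j], D') \<in> set L" by (elim exE conjE)
  have "justified h (set L) (a, D)"
    unfolding justified_def prod.case
    by (intro disjI2 exI[of _ c] exI[of _ N] conjI step.hyps(1,2) L(2))
  from derivation_snoc[OF L(1) this] show ?case
    by (intro exI[of _ "L @ [(a, D)]"]) simp
qed

abbreviation (input) fact_address :: "nat \<Rightarrow> nat \<Rightarrow> nat" where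
  "fact_address s i \<equiv> prj [prj [s, i], 0]"

abbreviation (input) fact_type :: "nat \<Rightarrow> nat \<Rightarrow> nat" where
  "fact_type s i \<equiv> prj [prj [s, i], 1]"

text \<open>Identifiers are numbered by \<open>e\<close>. The conditions speak only of the values of
  \<open>len\<close> and \<open>prj\<close> at \<open>s\<close>, so they can be read at any number
  \<open>s\<close>, whether or not it codes a list of pairs.\<close>

definition coded_derivation :: "('d \<Rightarrow> nat) \<Rightarrow> (nat \<Rightarrow> nat) \<Rightarrow> nat \<Rightarrow> bool" where
  "coded_derivation e h s \<longleftrightarrow> (\<forall>i<len [s].
    (\<exists>D\<in>E. fact_type s i = e D \<and> P D h [fact_address s i]) \<or>
    (\<exists>r\<in>Rs. fact_type s i = e (fst r) \<and> h (fact_address s i) = code (fst (snd r)) \<and>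
      (\<forall>p\<in>snd (snd r). \<exists>k<i. fact_address s k = app [fact_address s i, fst p] \<and>
        fact_type s k = e (snd p))))"

text \<open>Premises stand at smaller positions, which allows induction on \<open>i\<close>. The set
  \<open>T\<close> contains every identifier that can occur, and injectivity of \<open>e\<close> on
  it recovers the identifier from its number.\<close>

lemma coded_derivation_sound:
  assumes s: "coded_derivation e h s" and inj: "inj_on e T"
    and T: "E \<subseteq> T" "\<forall>(D, c, N)\<in>Rs. D \<in> T \<and> snd ` N \<subseteq> T"
    and "i < len [s]" "D \<in> T" "fact_type s i = e D"
  shows "derivable h (fact_address s i) D"
  using assms(5-)
proof (induction i arbitrary: D rule: less_induct)
  case (less i)
  from s less.prems(1) have "(\<exists>D\<in>E. fact_type s i = e D \<and> P D h [fact_address s i]) \<or>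
    (\<exists>r\<in>Rs. fact_type s i = e (fst r) \<and> h (fact_address s i) = code (fst (snd r)) \<and>
      (\<forall>p\<in>snd (snd r). \<exists>k<i. fact_address s k = app [fact_address s i, fst p] \<and>
        fact_type s k = e (snd p)))"
    unfolding coded_derivation_def by (elim allE impE)
  then show ?case
  proof (elim disjE bexE conjE)
    fix D' assume D': "D' \<in> E" "fact_type s i = e D'" "P D' h [fact_address s i]"
    have "D' = D"
      using inj_onD[OF inj, of D' D] D'(1,2) T(1) less.prems(2,3) by auto
    with D' show ?thesis by (intro axiom) simp_all
  next
    fix r assume r: "r \<in> Rs" "fact_type s i = e (fst r)" "h (fact_address s i) = code (fst (snd r))"
      and prems: "\<forall>p\<in>snd (snd r). \<exists>k<i. fact_address s k = app [fact_address s i, fst p] \<and>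
        fact_type s k = e (snd p)"
    obtain D' c N where rule: "r = (D', c, N)" by (cases r)
    have N: "D' \<in> T" "snd ` N \<subseteq> T" using bspec[OF T(2) r(1)] rule by simp_all
    have "D' = D"
      using inj_onD[OF inj, of D' D] r(2) rule N(1) less.prems(2,3) by auto
    show ?thesis
    proof (rule step)
      show "(D, c, N) \<in> Rs" using r(1) rule \<open>D' = D\<close> by simp
      show "h (fact_address s i) = code c" using r(3) rule by simp
      fix j D'' assume p: "(j, D'') \<in> N"
      obtain k where k: "k < i" "fact_address s k = app [fact_address s i, j]" "fact_type s k = e D''"
        using bspec[OF prems, of "(j, D'')"] p rule by auto
      have "D'' \<in> T" using N(2) p by force
      from less.IH[OF k(1) less_trans[OF k(1) less.prems(1)] this k(3)]
      show "derivable h (app [fact_address s i, j]) D''" unfolding k(2) .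
    qed
  qed
qed

lemma coded_derivation_complete:
  assumes "derivable h a D"
  obtains s i where "coded_derivation e h s" "i < len [s]" "fact_address s i = a" "fact_type s i = e D"
proof -
  obtain L where L: "derivation h L" "(a, D) \<in> set L"
    using derivation_exists[OF assms] by blast
  \<comment> \<open>Facts become coded pairs in the same order, so positions in \<open>L\<close> and
    in \<open>s\<close> agree.\<close>
  define s where "s = sq (map (\<lambda>(a, D). sq [a, e D]) L)"
  have len_s: "len [s] = length L" unfolding s_def by (simp add: len)
  have "prj [s, i] = sq [fst (L ! i), e (snd (L ! i))]" if "i < length L" for i
    using prj[of i "map (\<lambda>(a, D). sq [a, e D]) L"] that unfolding s_def by (simp add: case_prod_beta)
  then have facts: "fact_address s i = fst (L ! i)" "fact_type s i = e (snd (L ! i))" if "i < length L" for i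
    using that by (simp_all add: prj_pair)
  have "coded_derivation e h s"
    unfolding coded_derivation_def len_s
  proof (intro allI impI)
    fix i assume i: "i < length L"
    obtain b D' where bD: "L ! i = (b, D')" by fastforce
    have "justified h (set (take i L)) (b, D')" using L(1) i bD unfolding derivation_def by metis
    then consider "D' \<in> E" "P D' h [b]"
      | c N where "(D', c, N) \<in> Rs" "h b = code c" "\<forall>(j, D'')\<in>N. (app [b, j], D'') \<in> set (take i L)"
      unfolding justified_def by blast
    then show "(\<exists>D\<in>E. fact_type s i = e D \<and> P D h [fact_address s i]) \<or>
      (\<exists>r\<in>Rs. fact_type s i = e (fst r) \<and> h (fact_address s i) = code (fst (snd r)) \<and>
      (\<forall>p\<in>snd (snd r). \<exists>k<i. fact_address s k = app [fact_address s i, fst p] \<and>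
        fact_type s k = e (snd p)))"
    proof cases
      case 1
      then show ?thesis unfolding facts[OF i] bD by auto
    next
      case 2
      have "\<exists>k<i. fact_address s k = app [b, fst p] \<and> fact_type s k = e (snd p)" if "p \<in> N" for p
      proof -
        have "(app [b, fst p], snd p) \<in> set (take i L)" using 2(3) that by force
        then obtain k where "k < i" "k < length L" "L ! k = (app [b, fst p], snd p)"
          by (auto simp: in_set_conv_nth)
        then show ?thesis using facts[of k] by auto
      qed
      with 2 show ?thesis unfolding facts[OF i] bD by (intro disjI2 bexI[of _ "(D', c, N)"]) auto
    qed
  qed
  moreover obtain i where "i < length L" "L ! i = (a, D)"
    using L(2) by (auto simp: in_set_conv_nth)
  ultimately show thesis using facts len_s by (intro that[of s i]) auto
qed

text \<open>Below the quantifier over \<open>s\<close> there are only bounded quantifiers, finite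
  conjunctions and disjunctions, equations and the relations \<open>P\<close>; the level
  \<open>Suc n\<close> has a leading \<open>\<exists>\<close> that absorbs \<open>s\<close>.\<close>

lemma sigma_rel_derivable:
  assumes P: "\<And>D. D \<in> E \<Longrightarrow> sigma_rel (Suc n) 1 (P D)"
  shows "sigma_rel (Suc n) 1 (\<lambda>h xs. derivable h (hd xs) D)"
proof -
  \<comment> \<open>\<open>D\<close> is inserted separately since it may occur neither in
    \<open>E\<close> nor in a rule.\<close>
  define T where "T = insert D (E \<union> (\<Union>(D, c, N)\<in>Rs. insert D (snd ` N)))"
  have T: "D \<in> T" "E \<subseteq> T" "\<forall>(D, c, N)\<in>Rs. D \<in> T \<and> snd ` N \<subseteq> T"
    unfolding T_def by fastforce+
  have "finite T"
    unfolding T_def using finite_E finite_Rs finite_premises by (auto simp: case_prod_beta)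
  then obtain e :: "'d \<Rightarrow> nat" where e: "inj_on e T"
    using finite_imp_inj_to_nat_seg by blast
  have vars: "pr_function (Suc (Suc k)) (\<lambda>h xs. hd (tl xs))"
    "pr_function (Suc (Suc (Suc k))) (\<lambda>h xs. hd (tl (tl xs)))" for k
    using pr_function_tl[OF pr_function_hd] pr_function_tl[OF pr_function_tl[OF pr_function_hd]] by auto
  have fin: "finite (snd (snd r))" if "r \<in> Rs" for r
    using finite_premises that by (metis prod.collapse)
  have "sigma_rel (Suc n) (Suc 0)
    (\<lambda>h xs. \<exists>s. coded_derivation e h s \<and> (\<exists>i<len [s]. fact_address s i = hd xs \<and> fact_type s i = e D))"
    unfolding coded_derivation_def
    by (rule sigma_rel_ex, intro sigma_rel_conj sigma_rel_bounded_all sigma_rel_bounded_ex sigma_rel_disj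
        sigma_rel_finite_bex finite_E finite_Rs sigma_rel_finite_ball fin sigma_rel_eq
        sigma_rel_subst1[OF P] pr_function_hd vars pr_function_oracle pr_function_len pr_function_prj
        pr_function_app pr_function_const)
  moreover have "(\<exists>s. coded_derivation e h s \<and> (\<exists>i<len [s]. fact_address s i = a \<and> fact_type s i = e D))
      \<longleftrightarrow> derivable h a D" for h a
  proof
    assume "\<exists>s. coded_derivation e h s \<and> (\<exists>i<len [s]. fact_address s i = a \<and> fact_type s i = e D)"
    then show "derivable h a D"
      by (auto dest: coded_derivation_sound[OF _ e T(2,3) _ T(1)])
  qed (rule coded_derivation_complete[of h a D e], assumption, blast)
  ultimately show ?thesis by simp
qed

end

section \<open>Subterms represented at an address\<close>

text \<open>Passing to a child lengthens the address and leaves \<open>h\<close> alone. This matters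
  because \<open>h\<close> is the value of the only function variable and cannot be replaced by a
  shifted function inside the formula.\<close>

definition represents_at ::
  "(nat list \<Rightarrow> nat) \<Rightarrow> ('c \<Rightarrow> nat) \<Rightarrow> (nat \<Rightarrow> nat) \<Rightarrow> nat list \<Rightarrow> 'c hterm \<Rightarrow> bool" where
  "represents_at sq code h a t \<longleftrightarrow> (\<forall>b c. label_at t b = Some c \<longrightarrow> h (sq (a @ b)) = code c)"

lemma represents_at_Nil: "represents_at sq code h [] t \<longleftrightarrow> represents sq code h t"
  by (simp add: represents_at_def represents_def)

lemma represents_at_root: "represents_at sq code h a (Node c ts) \<Longrightarrow> h (sq a) = code c"
  unfolding represents_at_def by (metis append_Nil2 label_at.simps(1))

lemma represents_at_child:
  assumes "represents_at sq code h a (Node c ts)" "i < length ts"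
  shows "represents_at sq code h (a @ [i]) (ts ! i)"
  unfolding represents_at_def
proof (intro allI impI)
  fix b c' assume "label_at (ts ! i) b = Some c'"
  then have "label_at (Node c ts) (i # b) = Some c'" using assms(2) by simp
  then have "h (sq (a @ i # b)) = code c'" using assms(1) unfolding represents_at_def by blast
  then show "h (sq ((a @ [i]) @ b)) = code c'" by simp
qed

text \<open>By the convention on complements, a set is \<open>\<Pi>\<^sub>n\<close>-definable if its complement is
  \<open>\<Sigma>\<^sub>n\<close>-definable. The address argument of the defining relation makes it applicable to subterms.\<close>

definition sigma_definable ::
  "(nat list \<Rightarrow> nat) \<Rightarrow> ('c \<Rightarrow> nat) \<Rightarrow> 'c hterm set \<Rightarrow> nat \<Rightarrow> 'c hterm set \<Rightarrow> bool" where
  "sigma_definable sq code H n X \<longleftrightarrow> (\<exists>P. sigma_rel n 1 P \<and>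
    (\<forall>h a. \<forall>t\<in>H. represents_at sq code h a t \<longrightarrow> (P h [sq a] \<longleftrightarrow> t \<in> X)))"

text \<open>This is the lift needed when an inductive bundle follows a Pi_n system or a coinductive
  one follows a Sigma_n system.\<close>

lemma sigma_definable_Compl_Suc:
  assumes "sigma_definable sq code H n X"
  shows "sigma_definable sq code H (Suc n) (- X)"
proof -
  obtain P where P: "sigma_rel n 1 P"
    "\<forall>h a. \<forall>t\<in>H. represents_at sq code h a t \<longrightarrow> (P h [sq a] \<longleftrightarrow> t \<in> X)"
    using assms unfolding sigma_definable_def by blast
  show ?thesis
    unfolding sigma_definable_def
    by (intro exI[of _ "\<lambda>h xs. \<not> P h xs"] conjI sigma_rel_neg_Suc P(1)) (use P(2) in simp)
qed

text \<open>The address is fixed to the root, whose code \<open>sq []\<close> is a constant; hence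
  no number variable remains free.\<close>

lemma sigma_definable_formulas:
  assumes "sigma_definable sq code H n X"
  shows "\<exists>\<phi>. sigma_formula n \<phi> \<and> wf_formula 0 \<phi> \<and>
      (\<forall>h. \<forall>t\<in>H. represents sq code h t \<longrightarrow> (holds h [] \<phi> \<longleftrightarrow> t \<in> X))"
    and "\<exists>\<phi>. pi_formula n \<phi> \<and> wf_formula 0 \<phi> \<and>
      (\<forall>h. \<forall>t\<in>H. represents sq code h t \<longrightarrow> (holds h [] \<phi> \<longleftrightarrow> t \<notin> X))"
proof -
  obtain P where P: "sigma_rel n 1 P"
    "\<forall>h a. \<forall>t\<in>H. represents_at sq code h a t \<longrightarrow> (P h [sq a] \<longleftrightarrow> t \<in> X)"
    using assms unfolding sigma_definable_def by blast
  have X: "P h [sq []] \<longleftrightarrow> t \<in> X" if "t \<in> H" "represents sq code h t" for h t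
    using P(2) that by (simp flip: represents_at_Nil)
  have "sigma_rel n 0 (\<lambda>h xs. P h [sq []])"
    by (intro sigma_rel_subst1[OF P(1)] pr_function_const)
  from sigma_rel_formulas[OF this] obtain \<phi> \<psi> where
    "sigma_formula n \<phi>" "wf_formula 0 \<phi>" "\<And>h. holds h [] \<phi> \<longleftrightarrow> P h [sq []]"
    "pi_formula n \<psi>" "wf_formula 0 \<psi>" "\<And>h. holds h [] \<psi> \<longleftrightarrow> \<not> P h [sq []]"
    by auto
  with X show "\<exists>\<phi>. sigma_formula n \<phi> \<and> wf_formula 0 \<phi> \<and>
      (\<forall>h. \<forall>t\<in>H. represents sq code h t \<longrightarrow> (holds h [] \<phi> \<longleftrightarrow> t \<in> X))"
    and "\<exists>\<phi>. pi_formula n \<phi> \<and> wf_formula 0 \<phi> \<and>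
      (\<forall>h. \<forall>t\<in>H. represents sq code h t \<longrightarrow> (holds h [] \<phi> \<longleftrightarrow> t \<notin> X))"
    by auto
qed

section \<open>The canonical interpretation of a bundle\<close>

lemma hyperterms_Node:
  "Node c ts \<in> hyperterms C ar \<longleftrightarrow> c \<in> C \<and> length ts = ar c \<and> set ts \<subseteq> hyperterms C ar"
  by (auto elim: hyperterms.cases intro: hyperterms.intros)

lemma interp_bundle_other: "D \<notin> set (type_ids B) \<Longrightarrow> interp_bundle C ar B \<rho> D = \<rho> D"
  by (cases B) auto

lemma cstatement_holds_mono:
  "cstatement_holds \<sigma> x s \<Longrightarrow> (\<And>D. \<sigma> D \<subseteq> \<sigma>' D) \<Longrightarrow> cstatement_holds \<sigma>' x s"
  unfolding cstatement_holds_def by (auto split: prod.splits intro: list_all2_mono dest: subsetD)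

lemma mem_interp_inductive:
  assumes "D \<in> set Ds"
  shows "x \<in> interp_bundle C ar (Inductive Ds R) \<rho> D \<longleftrightarrow>
    (\<forall>X. (\<forall>D\<in>set Ds. X D \<subseteq> hyperterms C ar) \<and> closed_under R (override_on \<rho> X (set Ds)) \<longrightarrow> x \<in> X D)"
  using assms by simp

lemma mem_interp_coinductive:
  assumes "D \<in> set Ds"
  shows "x \<in> interp_bundle C ar (Coinductive Ds \<psi>) \<rho> D \<longleftrightarrow>
    (\<exists>X. (\<forall>D\<in>set Ds. X D \<subseteq> hyperterms C ar) \<and> consistent_with Ds \<psi> (override_on \<rho> X (set Ds)) \<and> x \<in> X D)"
  using assms by auto

lemma interp_inductive_least:
  assumes "\<forall>D\<in>set Ds. X D \<subseteq> hyperterms C ar" "closed_under R (override_on \<rho> X (set Ds))" "D \<in> set Ds"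
  shows "interp_bundle C ar (Inductive Ds R) \<rho> D \<subseteq> X D"
proof
  fix x assume "x \<in> interp_bundle C ar (Inductive Ds R) \<rho> D"
  then show "x \<in> X D"
    unfolding mem_interp_inductive[OF assms(3)] using assms(1,2) by (elim allE impE) (rule conjI)
qed

text \<open>The Knaster-Tarski argument: premises are monotone in the interpretation, so they pass
  from the intersection to every closed \<open>X\<close>, which then contains the
  conclusion.\<close>

lemma interp_inductive_closed:
  assumes "\<And>D c Qs. (D, c, Qs) \<in> R \<Longrightarrow> D \<in> set Ds"
  shows "closed_under R (interp_bundle C ar (Inductive Ds R) \<rho>)" (is "closed_under R ?\<rho>")
  unfolding closed_under_def
proof clarify
  fix D c Qs ys
  assume R: "(D, c, Qs) \<in> R" and ys: "list_all2 (\<lambda>y Q. y \<in> ?\<rho> Q) ys Qs"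
  show "Node c ys \<in> ?\<rho> D"
    unfolding mem_interp_inductive[OF assms[OF R]]
  proof (intro allI impI, elim conjE)
    fix X
    assume X: "\<forall>D\<in>set Ds. X D \<subseteq> hyperterms C ar" "closed_under R (override_on \<rho> X (set Ds))"
    have sub: "?\<rho> Q \<subseteq> override_on \<rho> X (set Ds) Q" for Q
      using interp_inductive_least[OF X, of Q] interp_bundle_other[of Q "Inductive Ds R" C ar \<rho>]
      by (cases "Q \<in> set Ds") (simp_all del: interp_bundle.simps)
    have "list_all2 (\<lambda>y Q. y \<in> override_on \<rho> X (set Ds) Q) ys Qs"
      by (rule list_all2_mono[OF ys]) (rule subsetD[OF sub])
    then have "Node c ys \<in> override_on \<rho> X (set Ds) D"
      using bspec[OF X(2)[unfolded closed_under_def] R] by simp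
    then show "Node c ys \<in> X D" using assms[OF R] by simp
  qed
qed

lemma interp_coinductive_greatest:
  assumes "\<forall>D\<in>set Ds. X D \<subseteq> hyperterms C ar" "consistent_with Ds \<psi> (override_on \<rho> X (set Ds))"
    "D \<in> set Ds"
  shows "X D \<subseteq> interp_bundle C ar (Coinductive Ds \<psi>) \<rho> D"
proof
  fix x assume "x \<in> X D"
  then show "x \<in> interp_bundle C ar (Coinductive Ds \<psi>) \<rho> D"
    unfolding mem_interp_coinductive[OF assms(3)] using assms(1,2) by (intro exI[of _ X] conjI)
qed

text \<open>Dually, a member of the union lies in one consistent \<open>X\<close>, and the statement
  it satisfies there survives enlarging the interpretation.\<close>

lemma interp_coinductive_consistent:
  "consistent_with Ds \<psi> (interp_bundle C ar (Coinductive Ds \<psi>) \<rho>)" (is "consistent_with Ds \<psi> ?\<rho>")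
  unfolding consistent_with_def
proof (intro ballI)
  fix D x assume D: "D \<in> set Ds" and x: "x \<in> ?\<rho> D"
  from x obtain X where X: "\<forall>D\<in>set Ds. X D \<subseteq> hyperterms C ar"
    "consistent_with Ds \<psi> (override_on \<rho> X (set Ds))" "x \<in> X D"
    unfolding mem_interp_coinductive[OF D] by (elim exE conjE)
  from X(3) have "x \<in> override_on \<rho> X (set Ds) D" using D by simp
  then have "\<exists>s\<in>set (\<psi> D). cstatement_holds (override_on \<rho> X (set Ds)) x s"
    using X(2) D unfolding consistent_with_def by simp
  then obtain s where s: "s \<in> set (\<psi> D)" "cstatement_holds (override_on \<rho> X (set Ds)) x s"
    by (elim bexE)
  have "override_on \<rho> X (set Ds) Q \<subseteq> ?\<rho> Q" for Q
    using interp_coinductive_greatest[OF X(1,2), of Q] interp_bundle_other[of Q "Coinductive Ds \<psi>" C ar \<rho>]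
    by (cases "Q \<in> set Ds") (simp_all del: interp_bundle.simps)
  from s(1) cstatement_holds_mono[OF s(2) this] show "\<exists>s\<in>set (\<psi> D). cstatement_holds ?\<rho> x s"
    by (rule bexI[rotated])
qed

text \<open>For an inductive bundle the tuple of all hyper-terms is itself closed. Thus the
  intersection is over a nonempty family; the empty one would give all trees.\<close>

lemma interp_bundle_hyperterms:
  assumes \<rho>: "\<And>D. \<rho> D \<subseteq> hyperterms C ar" and B: "bundle_ok C ar A B"
  shows "interp_bundle C ar B \<rho> D \<subseteq> hyperterms C ar"
proof (cases B)
  case (Inductive Ds R)
  let ?X = "\<lambda>_. hyperterms C ar"
  have sub: "override_on \<rho> ?X (set Ds) Q \<subseteq> hyperterms C ar" for Q
    using \<rho>[of Q] by (cases "Q \<in> set Ds") simp_all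
  have "Node c ys \<in> override_on \<rho> ?X (set Ds) D"
    if R: "(D, c, Qs) \<in> R" and ys: "list_all2 (\<lambda>y Q. y \<in> override_on \<rho> ?X (set Ds) Q) ys Qs" for D c Qs ys
  proof -
    have R': "D \<in> set Ds" "c \<in> C" "length Qs = ar c"
      using B R unfolding Inductive by (auto simp: cstatement_ok_def)
    have "ys ! i \<in> hyperterms C ar" if "i < length ys" for i
      by (rule subsetD[OF sub list_all2_nthD[OF ys that]])
    then have "set ys \<subseteq> hyperterms C ar" by (auto simp: in_set_conv_nth)
    then show ?thesis using R' list_all2_lengthD[OF ys] by (simp add: hyperterms_Node)
  qed
  then have "closed_under R (override_on \<rho> ?X (set Ds))"
    unfolding closed_under_def by (intro ballI) auto
  from interp_inductive_least[OF _ this, of C ar D]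
  show ?thesis
    unfolding Inductive using \<rho>[of D] interp_bundle_other[of D "Inductive Ds R" C ar \<rho>]
    by (cases "D \<in> set Ds") (simp_all del: interp_bundle.simps)
next
  case (Coinductive Ds \<psi>)
  show ?thesis
  proof (cases "D \<in> set Ds")
    case True
    then show ?thesis
      unfolding Coinductive by (intro subsetI, unfold mem_interp_coinductive[OF True]) auto
  next
    case False
    then show ?thesis
      unfolding Coinductive using \<rho>[of D] by simp
  qed
qed

section \<open>Initial segments of a data-system\<close>

lemma canonical_interp_append:
  "canonical_interp C ar (Bs @ [B]) = interp_bundle C ar B (canonical_interp C ar Bs)"
  by (simp add: canonical_interp_def)

abbreviation system_ids :: "('c, 'd) type_bundle list \<Rightarrow> 'd set" where
  "system_ids Bs \<equiv> \<Union>B\<in>set Bs. set (type_ids B)"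

lemma system_ids_take: "i < length Bs \<Longrightarrow> system_ids (take (Suc i) Bs) = (\<Union>j\<le>i. set (type_ids (Bs ! j)))"
  using nth_image[of "Suc i" Bs] by (simp add: atLeast0LessThan lessThan_Suc_atMost flip: nth_image)

lemma data_system_take:
  assumes "data_system C ar Bs"
  shows "data_system C ar (take m Bs)"
  unfolding data_system_def
proof (intro conjI allI impI)
  have "concat (map type_ids Bs) =
      concat (map type_ids (take m Bs)) @ concat (map type_ids (drop m Bs))"
    by (metis append_take_drop_id concat_append map_append)
  then show "distinct (concat (map type_ids (take m Bs)))"
    using assms unfolding data_system_def by simp
  fix i assume "i < length (take m Bs)"
  then show "bundle_ok C ar (\<Union>j\<le>i. set (type_ids (take m Bs ! j))) (take m Bs ! i)"
    using assms by (simp add: data_system_def)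
qed

lemma data_system_appendD:
  assumes "data_system C ar (Bs @ [B])"
  shows "data_system C ar Bs" "bundle_ok C ar (system_ids Bs \<union> set (type_ids B)) B"
    "system_ids Bs \<inter> set (type_ids B) = {}"
proof -
  show "data_system C ar Bs" using data_system_take[OF assms, of "length Bs"] by simp
  have "bundle_ok C ar (\<Union>j\<le>length Bs. set (type_ids ((Bs @ [B]) ! j))) ((Bs @ [B]) ! length Bs)"
    using conjunct2[OF assms[unfolded data_system_def], THEN spec, of "length Bs"] by simp
  then have "bundle_ok C ar (system_ids (Bs @ [B])) B"
    using system_ids_take[of "length Bs" "Bs @ [B]"] by simp
  then show "bundle_ok C ar (system_ids Bs \<union> set (type_ids B)) B" by (simp add: Un_commute)
  show "system_ids Bs \<inter> set (type_ids B) = {}"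
    using assms unfolding data_system_def by auto
qed

lemma canonical_interp_hyperterms:
  "data_system C ar Bs \<Longrightarrow> canonical_interp C ar Bs D \<subseteq> hyperterms C ar"
proof (induction Bs arbitrary: D rule: rev_induct)
  case Nil
  then show ?case by (simp add: canonical_interp_def)
next
  case (snoc B Bs)
  show ?case
    unfolding canonical_interp_append
    by (rule interp_bundle_hyperterms[OF snoc.IH]) (rule data_system_appendD[OF snoc.prems])+
qed

text \<open>Identifiers of different bundles are distinct, so later bundles leave the earlier
  interpretations untouched.\<close>

lemma canonical_interp_take:
  assumes "data_system C ar Bs" "D \<in> system_ids (take m Bs)"
  shows "canonical_interp C ar (take m Bs) D = canonical_interp C ar Bs D"
  using assms
proof (induction Bs rule: rev_induct)
  case (snoc B Bs)
  show ?case
  proof (cases "m \<le> length Bs")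
    case True
    then have "D \<in> system_ids (take m Bs)" using snoc.prems(2) by simp
    moreover from this have "D \<in> system_ids Bs" by (blast dest: in_set_takeD)
    ultimately show ?thesis
      using snoc.IH data_system_appendD(1,3)[OF snoc.prems(1)] True
      by (simp add: canonical_interp_append interp_bundle_other disjoint_iff)
  qed simp
qed simp

section \<open>Definability of the types\<close>

text \<open>A finite box that contains the rules of both kinds of bundle: conclusion, constructor,
  and a set of premises whose indices lie below some arity.\<close>

lemma finite_rule_space:
  fixes ar :: "'c \<Rightarrow> nat"
  assumes "finite C" "finite A"
  shows "finite (A \<times> C \<times> Pow ((\<Union>c\<in>C. {..<ar c}) \<times> A))"
  using assms by (intro finite_cartesian_product finite_Pow_iff[THEN iffD2] finite_UN_I finite_lessThan)

context sequence_coding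
begin

lemma sigma_definable_inductive:
  fixes C :: "'c set" and ar :: "'c \<Rightarrow> nat" and \<rho> :: "('c, 'd) env"
  defines "H \<equiv> hyperterms C ar"
  assumes C: "finite C" "inj_on code C" and \<rho>: "\<And>D. \<rho> D \<subseteq> H"
    and A: "finite A" "A \<inter> set Ds = {}" "\<And>D. D \<in> A \<Longrightarrow> sigma_definable sq code H (Suc n) (\<rho> D)"
    and B: "bundle_ok C ar (A \<union> set Ds) (Inductive Ds R)"
    and D: "D \<in> set Ds"
  shows "sigma_definable sq code H (Suc n) (interp_bundle C ar (Inductive Ds R) \<rho> D)"
proof -
  let ?\<rho> = "interp_bundle C ar (Inductive Ds R) \<rho>"
  have R: "D \<in> set Ds" "c \<in> C" "length Qs = ar c" "set Qs \<subseteq> A \<union> set Ds" if "(D, c, Qs) \<in> R" for D c Qs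
    using bspec[OF B[unfolded bundle_ok.simps] that] by (simp_all add: cstatement_ok_def)
  obtain P where P: "\<And>D. D \<in> A \<Longrightarrow> sigma_rel (Suc n) 1 (P D)"
    "\<And>D h a t. D \<in> A \<Longrightarrow> t \<in> H \<Longrightarrow> represents_at sq code h a t \<Longrightarrow> P D h [sq a] \<longleftrightarrow> t \<in> \<rho> D"
    using A(3) unfolding sigma_definable_def by metis
  define Rs where "Rs = (\<lambda>(D, c, Qs). (D, c, (\<lambda>j. (j, Qs ! j)) ` {..<length Qs})) ` R"
  have RsI: "(D, c, (\<lambda>j. (j, Qs ! j)) ` {..<length Qs}) \<in> Rs" if "(D, c, Qs) \<in> R" for D c Qs
    unfolding Rs_def by (rule image_eqI[OF _ that]) simp
  have RsE: "\<exists>Qs. (D, c, Qs) \<in> R \<and> N = (\<lambda>j. (j, Qs ! j)) ` {..<length Qs}" if "(D, c, N) \<in> Rs" for D c N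
    using that unfolding Rs_def by auto
  have "Rs \<subseteq> (A \<union> set Ds) \<times> C \<times> Pow ((\<Union>c\<in>C. {..<ar c}) \<times> (A \<union> set Ds))"
  proof
    fix r assume "r \<in> Rs"
    obtain D c N where r: "r = (D, c, N)" by (cases r)
    obtain Qs where Qs: "(D, c, Qs) \<in> R" "N = (\<lambda>j. (j, Qs ! j)) ` {..<length Qs}"
      using RsE \<open>r \<in> Rs\<close> r by blast
    have "N \<subseteq> (\<Union>c\<in>C. {..<ar c}) \<times> (A \<union> set Ds)"
      unfolding Qs(2) using R(2,3)[OF Qs(1)] subsetD[OF R(4)[OF Qs(1)] nth_mem] by blast
    then show "r \<in> (A \<union> set Ds) \<times> C \<times> Pow ((\<Union>c\<in>C. {..<ar c}) \<times> (A \<union> set Ds))"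
      using r R[OF Qs(1)] by simp
  qed
  then have "finite Rs"
    using finite_rule_space[OF C(1), of "A \<union> set Ds" ar] A(1) by (auto elim: finite_subset)
  moreover have "finite N" if "(D, c, N) \<in> Rs" for D c N
    using RsE[OF that] by auto
  ultimately interpret derivations sq len prj app code A P Rs
    using A(1) by unfold_locales
  \<comment> \<open>Rule induction, with address and term left general so that it can descend to
    children. The label read from \<open>h\<close> determines the constructor because
    \<open>code\<close> is injective on \<open>C\<close>.\<close>
  have sound: "t \<in> ?\<rho> D"
    if "derivable h b D" "b = sq a" "t \<in> H" "represents_at sq code h a t" for h b D a t
    using that
  proof (induction arbitrary: a t)
    case (axiom D b)
    then have "D \<notin> set Ds" using A(2) by blast
    then show ?case using P(2)[of D t h a] axiom by simp
  next
    case (step D c N b)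
    obtain Qs where Qs: "(D, c, Qs) \<in> R" "N = (\<lambda>j. (j, Qs ! j)) ` {..<length Qs}"
      using RsE step.hyps(1) by blast
    obtain c' ts where t: "t = Node c' ts" by (cases t)
    have ts: "c' \<in> C" "length ts = ar c'" "set ts \<subseteq> H"
      using step.prems(2) unfolding t H_def hyperterms_Node by simp_all
    have "code c' = code c"
      using represents_at_root step.prems(1,3) step.hyps(2) t by metis
    then have "c' = c" using inj_onD[OF C(2) _ ts(1) R(2)[OF Qs(1)]] by simp
    have len: "length ts = length Qs" using ts(2) R(3)[OF Qs(1)] \<open>c' = c\<close> by simp
    have "ts ! j \<in> ?\<rho> (Qs ! j)" if j: "j < length ts" for j
    proof (rule step.IH)
      show "(j, Qs ! j) \<in> N" unfolding Qs(2) using j len by simp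
      show "app [b, j] = sq (a @ [j])" using step.prems(1) app by simp
      show "ts ! j \<in> H" using ts(3) nth_mem[OF j] by (rule subsetD)
      show "represents_at sq code h (a @ [j]) (ts ! j)"
        using step.prems(3) j unfolding t by (rule represents_at_child)
    qed
    then have "list_all2 (\<lambda>y Q. y \<in> ?\<rho> Q) ts Qs"
      using len by (intro list_all2_all_nthI)
    moreover have "closed_under R ?\<rho>" by (rule interp_inductive_closed) (rule R(1))
    ultimately show ?case
      using bspec[OF _ Qs(1), of "\<lambda>(D, c, Qs). \<forall>ys. list_all2 (\<lambda>y Q. y \<in> ?\<rho> Q) ys Qs \<longrightarrow> Node c ys \<in> ?\<rho> D"]
      unfolding closed_under_def t \<open>c' = c\<close> prod.case by blast
  qed
  \<comment> \<open>Closure concerns all hyper-terms, not only subterms of a given one, so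
    \<open>h\<close> and \<open>a\<close> are quantified here. A representation of a term is also
    one of its children at longer addresses, hence the universal quantifier passes from children to
    parent.\<close>
  define X where "X D = {t \<in> H. \<forall>h a. represents_at sq code h a t \<longrightarrow> derivable h (sq a) D}" for D
  let ?\<sigma> = "override_on \<rho> X (set Ds)"
  have \<sigma>: "t \<in> H" "represents_at sq code h a t \<Longrightarrow> derivable h (sq a) Q"
    if "t \<in> ?\<sigma> Q" "Q \<in> A \<union> set Ds" for t h a Q
  proof -
    show "t \<in> H" using that \<rho>[of Q] by (cases "Q \<in> set Ds") (auto simp: X_def)
    then show "derivable h (sq a) Q" if "represents_at sq code h a t"
      using \<open>t \<in> ?\<sigma> Q\<close> \<open>Q \<in> A \<union> set Ds\<close> that P(2)[of Q t h a]
      by (cases "Q \<in> set Ds") (auto simp: X_def intro: axiom)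
  qed
  have "closed_under R ?\<sigma>"
    unfolding closed_under_def
  proof clarify
    fix D c Qs ys assume r: "(D, c, Qs) \<in> R" and ys: "list_all2 (\<lambda>y Q. y \<in> ?\<sigma> Q) ys Qs"
    have len: "length ys = length Qs" using ys by (rule list_all2_lengthD)
    have Qs: "Qs ! j \<in> A \<union> set Ds" if "j < length ys" for j
      using subsetD[OF R(4)[OF r] nth_mem] that len by simp
    have mem: "ys ! j \<in> ?\<sigma> (Qs ! j)" if "j < length ys" for j
      using ys that by (rule list_all2_nthD)
    have "Node c ys \<in> H"
      unfolding H_def hyperterms_Node using R(2,3)[OF r] len \<sigma>(1)[OF mem Qs]
      by (auto simp: in_set_conv_nth H_def)
    moreover have "derivable h (sq a) D" if rep: "represents_at sq code h a (Node c ys)" for h a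
    proof (rule step[OF RsI[OF r]])
      show "h (sq a) = code c" using rep by (rule represents_at_root)
      fix j Q assume "(j, Q) \<in> (\<lambda>j. (j, Qs ! j)) ` {..<length Qs}"
      then have j: "j < length ys" "Q = Qs ! j" using len by auto
      from \<sigma>(2)[OF mem[OF j(1)] Qs[OF j(1)] represents_at_child[OF rep j(1)]]
      show "derivable h (app [sq a, j]) Q" unfolding app j(2) .
    qed
    ultimately have "Node c ys \<in> X D" unfolding X_def by simp
    then show "Node c ys \<in> ?\<sigma> D" using R(1)[OF r] by simp
  qed
  moreover have "\<forall>D\<in>set Ds. X D \<subseteq> hyperterms C ar" unfolding X_def H_def by blast
  ultimately have "?\<rho> D \<subseteq> X D" using D by (intro interp_inductive_least)
  then have complete: "derivable h (sq a) D" if "t \<in> ?\<rho> D" "represents_at sq code h a t" for h a t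
    using that unfolding X_def by blast
  have "derivable h (sq a) D \<longleftrightarrow> t \<in> ?\<rho> D" if "t \<in> H" "represents_at sq code h a t" for h a t
    using sound[OF _ refl that] complete[OF _ that(2)] by (rule iffI)
  moreover have "sigma_rel (Suc n) 1 (\<lambda>h xs. derivable h (hd xs) D)"
    using P(1) by (rule sigma_rel_derivable)
  ultimately show ?thesis
    unfolding sigma_definable_def
    by (intro exI[of _ "\<lambda>h xs. derivable h (hd xs) D"]) (simp del: interp_bundle.simps)
qed

text \<open>The complement of a coinductive bundle is generated by finitary rules: by the negated
  deconstruction rule, a term with label \<open>c\<close> fails \<open>D\<close> once every statement of \<open>\<psi> D\<close> for the
  constructor \<open>c\<close> fails at some child.\<close>

lemma sigma_definable_Compl_coinductive:
  fixes C :: "'c set" and ar :: "'c \<Rightarrow> nat" and \<rho> :: "('c, 'd) env"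
  defines "H \<equiv> hyperterms C ar"
  assumes C: "finite C" "inj_on code C"
    and A: "finite A" "A \<inter> set Ds = {}" "\<And>D. D \<in> A \<Longrightarrow> sigma_definable sq code H (Suc n) (- \<rho> D)"
    and B: "bundle_ok C ar (A \<union> set Ds) (Coinductive Ds \<psi>)"
    and D: "D \<in> set Ds"
  shows "sigma_definable sq code H (Suc n) (- interp_bundle C ar (Coinductive Ds \<psi>) \<rho> D)"
proof -
  let ?\<rho> = "interp_bundle C ar (Coinductive Ds \<psi>) \<rho>"
  have \<psi>: "c \<in> C" "length Qs = ar c" "set Qs \<subseteq> A \<union> set Ds"
    if "D \<in> set Ds" "(c, Qs) \<in> set (\<psi> D)" for D c Qs
    using bspec[OF bspec[OF B[unfolded bundle_ok.simps] that(1)] that(2)] by (simp_all add: cstatement_ok_def)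
  obtain P where P: "\<And>D. D \<in> A \<Longrightarrow> sigma_rel (Suc n) 1 (P D)"
    "\<And>D h a t. D \<in> A \<Longrightarrow> t \<in> H \<Longrightarrow> represents_at sq code h a t \<Longrightarrow> P D h [sq a] \<longleftrightarrow> t \<notin> \<rho> D"
    using A(3) unfolding sigma_definable_def Compl_iff by metis
  \<comment> \<open>\<open>N\<close> must meet every statement of \<open>\<psi> D\<close> for
    \<open>c\<close> in at least one premise. If there is no such statement, \<open>N\<close> may be
    empty and the label alone refutes \<open>D\<close>.\<close>
  define Rs where "Rs = {(D, c, N). D \<in> set Ds \<and> c \<in> C \<and> N \<subseteq> {..<ar c} \<times> (A \<union> set Ds) \<and>
    (\<forall>Qs. (c, Qs) \<in> set (\<psi> D) \<longrightarrow> (\<exists>j<length Qs. (j, Qs ! j) \<in> N))}"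
  have RsD: "D \<in> set Ds" "c \<in> C" "N \<subseteq> {..<ar c} \<times> (A \<union> set Ds)"
    "\<And>Qs. (c, Qs) \<in> set (\<psi> D) \<Longrightarrow> \<exists>j<length Qs. (j, Qs ! j) \<in> N" if "(D, c, N) \<in> Rs" for D c N
    using that unfolding Rs_def by simp_all
  have "Rs \<subseteq> (A \<union> set Ds) \<times> C \<times> Pow ((\<Union>c\<in>C. {..<ar c}) \<times> (A \<union> set Ds))"
    unfolding Rs_def by fast
  then have "finite Rs"
    using finite_rule_space[OF C(1), of "A \<union> set Ds" ar] A(1) by (auto elim: finite_subset)
  moreover have "finite N" if "(D, c, N) \<in> Rs" for D c N
    using RsD(3)[OF that] by (rule finite_subset) (use A(1) in simp)
  ultimately interpret derivations sq len prj app code A P Rs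
    using A(1) by unfold_locales
  have sound: "t \<notin> ?\<rho> D"
    if "derivable h b D" "b = sq a" "t \<in> H" "represents_at sq code h a t" for h b D a t
    using that
  proof (induction arbitrary: a t)
    case (axiom D b)
    then have "D \<notin> set Ds" using A(2) by blast
    then show ?case using P(2)[of D t h a] axiom by simp
  next
    case (step D c N b)
    show ?case
    proof
      assume "t \<in> ?\<rho> D"
      then have "\<exists>s\<in>set (\<psi> D). cstatement_holds ?\<rho> t s"
        using interp_coinductive_consistent[unfolded consistent_with_def, THEN bspec, THEN bspec]
          RsD(1)[OF step.hyps(1)] by metis
      then obtain c' Qs where s: "(c', Qs) \<in> set (\<psi> D)" and "cstatement_holds ?\<rho> t (c', Qs)"
        by (elim bexE) (metis prod.collapse)
      then obtain ts where t: "t = Node c' ts" and ts: "list_all2 (\<lambda>y Q. y \<in> ?\<rho> Q) ts Qs"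
        unfolding cstatement_holds_def prod.case by (elim exE conjE)
      have "code c' = code c"
        using represents_at_root step.prems(1,3) step.hyps(2) t by metis
      then have "c' = c"
        using inj_onD[OF C(2) _ \<psi>(1)[OF RsD(1)[OF step.hyps(1)] s] RsD(2)[OF step.hyps(1)]] by simp
      obtain j where j: "j < length Qs" "(j, Qs ! j) \<in> N"
        using RsD(4)[OF step.hyps(1), of Qs] s \<open>c' = c\<close> by blast
      have len: "j < length ts" using j(1) list_all2_lengthD[OF ts] by simp
      \<comment> \<open>The rule has a premise at a child used by the very statement that
        \<open>t\<close> satisfies; the induction hypothesis denies that child its type.\<close>
      have "ts ! j \<notin> ?\<rho> (Qs ! j)"
      proof (rule step.IH[OF j(2)])
        show "app [b, j] = sq (a @ [j])" using step.prems(1) app by simp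
        show "ts ! j \<in> H"
          using step.prems(2) subsetD[OF _ nth_mem[OF len]] unfolding t H_def hyperterms_Node by simp
        show "represents_at sq code h (a @ [j]) (ts ! j)"
          using step.prems(3) len unfolding t by (rule represents_at_child)
      qed
      with list_all2_nthD[OF ts len] show False by simp
    qed
  qed
  \<comment> \<open>Dual to the inductive case: one representation without a refutation suffices for
    \<open>t\<close> to enter the candidate.\<close>
  define X where "X D = {t \<in> H. \<exists>h a. represents_at sq code h a t \<and> \<not> derivable h (sq a) D}" for D
  let ?\<sigma> = "override_on \<rho> X (set Ds)"
  have \<sigma>: "derivable h (sq a) Q"
    if "t \<notin> ?\<sigma> Q" "Q \<in> A \<union> set Ds" "t \<in> H" "represents_at sq code h a t" for t h a Q
    using that P(2)[of Q t h a] by (cases "Q \<in> set Ds") (auto simp: X_def intro: axiom)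
  have "consistent_with Ds \<psi> ?\<sigma>"
    unfolding consistent_with_def
  proof (intro ballI, rule ccontr)
    fix D t assume D: "D \<in> set Ds" and t: "t \<in> ?\<sigma> D"
      and fails: "\<not> (\<exists>s\<in>set (\<psi> D). cstatement_holds ?\<sigma> t s)"
    from t D obtain h a where t: "t \<in> H" "represents_at sq code h a t" "\<not> derivable h (sq a) D"
      by (auto simp: X_def)
    obtain c ts where Node: "t = Node c ts" by (cases t)
    have ts: "c \<in> C" "length ts = ar c" "set ts \<subseteq> H"
      using t(1) unfolding Node H_def hyperterms_Node by simp_all
    \<comment> \<open>All failures at children are collected. If every statement fails, this set
      meets each statement for \<open>c\<close>, so it is the premise set of a rule; its premises
      are derivable, contradicting the choice of \<open>h\<close> and \<open>a\<close>.\<close>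
    define N where "N = {(j, Q). j < ar c \<and> Q \<in> A \<union> set Ds \<and> ts ! j \<notin> ?\<sigma> Q}"
    have "\<exists>j<length Qs. (j, Qs ! j) \<in> N" if s: "(c, Qs) \<in> set (\<psi> D)" for Qs
    proof -
      have len: "length ts = length Qs" "length Qs = ar c" using ts(2) \<psi>(2)[OF D s] by simp_all
      have "\<not> cstatement_holds ?\<sigma> t (c, Qs)" using fails s by blast
      then have "\<not> list_all2 (\<lambda>y Q. y \<in> ?\<sigma> Q) ts Qs"
        unfolding cstatement_holds_def Node by simp
      then obtain j where j: "j < length Qs" "ts ! j \<notin> ?\<sigma> (Qs ! j)"
        using len(1) unfolding list_all2_conv_all_nth by auto
      moreover have "Qs ! j \<in> A \<union> set Ds" using \<psi>(3)[OF D s] nth_mem[OF j(1)] by (rule subsetD)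
      ultimately show ?thesis unfolding N_def using len(2) by auto
    qed
    moreover have "N \<subseteq> {..<ar c} \<times> (A \<union> set Ds)" unfolding N_def by blast
    ultimately have "(D, c, N) \<in> Rs" unfolding Rs_def using D ts(1) by simp
    then have "derivable h (sq a) D"
    proof (rule step)
      show "h (sq a) = code c" using t(2) unfolding Node by (rule represents_at_root)
      fix j Q assume "(j, Q) \<in> N"
      then have j: "j < length ts" "Q \<in> A \<union> set Ds" "ts ! j \<notin> ?\<sigma> Q"
        unfolding N_def using ts(2) by auto
      have "ts ! j \<in> H" using ts(3) nth_mem[OF j(1)] by (rule subsetD)
      from \<sigma>[OF j(3,2) this represents_at_child[OF t(2)[unfolded Node] j(1)]]
      show "derivable h (app [sq a, j]) Q" unfolding app .
    qed
    with t(3) show False by simp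
  qed
  moreover have "\<forall>D\<in>set Ds. X D \<subseteq> hyperterms C ar" unfolding X_def H_def by blast
  ultimately have "X D \<subseteq> ?\<rho> D" using D by (intro interp_coinductive_greatest)
  then have complete: "derivable h (sq a) D"
    if "t \<notin> ?\<rho> D" "t \<in> H" "represents_at sq code h a t" for h a t
    using that unfolding X_def by blast
  have "derivable h (sq a) D \<longleftrightarrow> t \<notin> ?\<rho> D" if "t \<in> H" "represents_at sq code h a t" for h a t
    using sound[OF _ refl that] complete[OF _ that] by (rule iffI)
  moreover have "sigma_rel (Suc n) 1 (\<lambda>h xs. derivable h (hd xs) D)"
    using P(1) by (rule sigma_rel_derivable)
  ultimately show ?thesis
    unfolding sigma_definable_def
    by (intro exI[of _ "\<lambda>h xs. derivable h (hd xs) D"]) (simp del: interp_bundle.simps)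
qed

section \<open>Induction along the sequence of bundles\<close>

lemma sigma_definable_append_inductive:
  assumes "finite C" "inj_on code C" "data_system C ar (Bs @ [B])" "is_inductive B"
    and Bs: "\<And>D. D \<in> system_ids Bs \<Longrightarrow>
      sigma_definable sq code (hyperterms C ar) (Suc n) (canonical_interp C ar Bs D)"
    and D: "D \<in> system_ids (Bs @ [B])"
  shows "sigma_definable sq code (hyperterms C ar) (Suc n) (canonical_interp C ar (Bs @ [B]) D)"
proof (cases "D \<in> set (type_ids B)")
  case True
  note ds = data_system_appendD[OF assms(3)]
  obtain Ds R where B: "B = Inductive Ds R" using assms(4) by (cases B) auto
  show ?thesis
    unfolding canonical_interp_append B
    by (rule sigma_definable_inductive[OF assms(1,2) canonical_interp_hyperterms[OF ds(1)] _ _ Bs])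
      (use ds(2,3) True B in auto)
next
  case False
  then show ?thesis
    using Bs D unfolding canonical_interp_append by (simp add: interp_bundle_other)
qed

lemma sigma_definable_Compl_append_coinductive:
  assumes "finite C" "inj_on code C" "data_system C ar (Bs @ [B])" "\<not> is_inductive B"
    and Bs: "\<And>D. D \<in> system_ids Bs \<Longrightarrow>
      sigma_definable sq code (hyperterms C ar) (Suc n) (- canonical_interp C ar Bs D)"
    and D: "D \<in> system_ids (Bs @ [B])"
  shows "sigma_definable sq code (hyperterms C ar) (Suc n) (- canonical_interp C ar (Bs @ [B]) D)"
proof (cases "D \<in> set (type_ids B)")
  case True
  note ds = data_system_appendD[OF assms(3)]
  obtain Ds \<psi> where B: "B = Coinductive Ds \<psi>" using assms(4) by (cases B) auto
  show ?thesis
    unfolding canonical_interp_append B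
    by (rule sigma_definable_Compl_coinductive[OF assms(1,2) _ _ Bs])
      (use ds(2,3) True B in auto)
next
  case False
  then show ?thesis
    using Bs D unfolding canonical_interp_append by (simp add: interp_bundle_other)
qed

text \<open>The claim that n is at least 1 is carried along because appending a bundle of the same
  kind requires the level in the form \<open>Suc m\<close>.\<close>

lemma system_definable:
  fixes C :: "'c set" and Bs :: "('c, 'd) type_bundle list"
  assumes C: "finite C" "inj_on code C"
  shows "sigma_system n Bs \<Longrightarrow> n \<ge> 1 \<and> (data_system C ar Bs \<longrightarrow> (\<forall>D\<in>system_ids Bs.
      sigma_definable sq code (hyperterms C ar) n (canonical_interp C ar Bs D)))"
    and "pi_system n Bs \<Longrightarrow> n \<ge> 1 \<and> (data_system C ar Bs \<longrightarrow> (\<forall>D\<in>system_ids Bs.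
      sigma_definable sq code (hyperterms C ar) n (- canonical_interp C ar Bs D)))"
proof (induction rule: sigma_system_pi_system.inducts)
  case (1 B)
  have "sigma_definable sq code (hyperterms C ar) (Suc 0) (canonical_interp C ar ([] @ [B]) D)"
    if "data_system C ar [B]" "D \<in> system_ids [B]" for D
    by (rule sigma_definable_append_inductive[OF C _ 1]) (use that in simp_all)
  then show ?case by simp
next
  case (2 B)
  have "sigma_definable sq code (hyperterms C ar) (Suc 0) (- canonical_interp C ar ([] @ [B]) D)"
    if "data_system C ar [B]" "D \<in> system_ids [B]" for D
    by (rule sigma_definable_Compl_append_coinductive[OF C _ 2]) (use that in simp_all)
  then show ?case by simp
next
  case (3 n Bs B)
  obtain m where n: "n = Suc m" using "3.IH" by (cases n) auto
  have "sigma_definable sq code (hyperterms C ar) (Suc m) (canonical_interp C ar (Bs @ [B]) D)"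
    if "data_system C ar (Bs @ [B])" "D \<in> system_ids (Bs @ [B])" for D
    by (rule sigma_definable_append_inductive[OF C that(1) "3.hyps"(2) _ that(2)])
      (unfold n[symmetric], erule bspec[OF mp[OF conjunct2[OF "3.IH"] data_system_appendD(1)[OF that(1)]]])
  then show ?case using n by simp
next
  case (4 n Bs B)
  \<comment> \<open>The earlier types are Sigma_n; a dummy quantifier makes their complements
    Sigma_(n+1), as the coinductive step requires.\<close>
  have "sigma_definable sq code (hyperterms C ar) (Suc n) (- canonical_interp C ar (Bs @ [B]) D)"
    if "data_system C ar (Bs @ [B])" "D \<in> system_ids (Bs @ [B])" for D
    by (rule sigma_definable_Compl_append_coinductive[OF C that(1) "4.hyps"(2) _ that(2)],
        rule sigma_definable_Compl_Suc)
      (erule bspec[OF mp[OF conjunct2[OF "4.IH"] data_system_appendD(1)[OF that(1)]]])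
  then show ?case by simp
next
  case (5 n Bs B)
  obtain m where n: "n = Suc m" using "5.IH" by (cases n) auto
  have "sigma_definable sq code (hyperterms C ar) (Suc m) (- canonical_interp C ar (Bs @ [B]) D)"
    if "data_system C ar (Bs @ [B])" "D \<in> system_ids (Bs @ [B])" for D
    by (rule sigma_definable_Compl_append_coinductive[OF C that(1) "5.hyps"(2) _ that(2)])
      (unfold n[symmetric], erule bspec[OF mp[OF conjunct2[OF "5.IH"] data_system_appendD(1)[OF that(1)]]])
  then show ?case using n by simp
next
  case (6 n Bs B)
  \<comment> \<open>Here the earlier types are known through their complements; complementing again
    costs one level.\<close>
  have *: "sigma_definable sq code (hyperterms C ar) (Suc n) X"
    if "sigma_definable sq code (hyperterms C ar) n (- X)" for X
    using sigma_definable_Compl_Suc[OF that] by simp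
  have "sigma_definable sq code (hyperterms C ar) (Suc n) (canonical_interp C ar (Bs @ [B]) D)"
    if "data_system C ar (Bs @ [B])" "D \<in> system_ids (Bs @ [B])" for D
    by (rule sigma_definable_append_inductive[OF C that(1) "6.hyps"(2) _ that(2)], rule *)
      (erule bspec[OF mp[OF conjunct2[OF "6.IH"] data_system_appendD(1)[OF that(1)]]])
  then show ?case by simp
qed

end

lemma pr_coding_sequence_coding:
  assumes "pr_coding sq"
  obtains len prj app where "sequence_coding sq len prj app"
proof -
  obtain len prj app where
    "primitive_recursive 1 len" "\<forall>s. len [sq s] = length s"
    "primitive_recursive 2 prj" "\<forall>s. \<forall>i<length s. prj [sq s, i] = s ! i"
    "primitive_recursive 2 app" "\<forall>s x. app [sq s, x] = sq (s @ [x])"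
    using assms unfolding pr_coding_def by (elim conjE exE)
  then have "sequence_coding sq len prj app" by unfold_locales simp_all
  then show thesis by (rule that)
qed

theorem theorem6p3:
  fixes C :: "'c set" and ar :: "'c \<Rightarrow> nat" and Bs :: "('c, 'd) type_bundle list"
    and sq :: "nat list \<Rightarrow> nat" and code :: "'c \<Rightarrow> nat" and n :: nat
  assumes "finite C" and "data_system C ar Bs"
    and "pr_coding sq" and "inj_on code C"
    and "n \<ge> 1"
  shows "(\<forall>D. sigma_type n Bs D \<longrightarrow>
            (\<exists>\<phi>. sigma_formula n \<phi> \<and> wf_formula 0 \<phi> \<and>
              (\<forall>h. \<forall>t\<in>hyperterms C ar. represents sq code h t \<longrightarrow>
                 (holds h [] \<phi> \<longleftrightarrow> t \<in> canonical_interp C ar Bs D)))) \<and>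
         (\<forall>D. pi_type n Bs D \<longrightarrow>
            (\<exists>\<phi>. pi_formula n \<phi> \<and> wf_formula 0 \<phi> \<and>
              (\<forall>h. \<forall>t\<in>hyperterms C ar. represents sq code h t \<longrightarrow>
                 (holds h [] \<phi> \<longleftrightarrow> t \<in> canonical_interp C ar Bs D))))"
proof (intro conjI allI impI)
  obtain len prj app where "sequence_coding sq len prj app"
    using assms(3) by (rule pr_coding_sequence_coding)
  then interpret sequence_coding sq len prj app .
  \<comment> \<open>The rank of a type is that of the initial segment ending with its bundle, so
    definability is obtained there and transferred to the whole system.\<close>
  have take: "D \<in> system_ids (take (Suc i) Bs)" "data_system C ar (take (Suc i) Bs)"
    "canonical_interp C ar (take (Suc i) Bs) D = canonical_interp C ar Bs D"
    if i: "i < length Bs" "D \<in> set (type_ids (Bs ! i))" for i D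
  proof -
    show "D \<in> system_ids (take (Suc i) Bs)" unfolding system_ids_take[OF i(1)] using i(2) by (intro UN_I[of i]) simp_all
    then show "canonical_interp C ar (take (Suc i) Bs) D = canonical_interp C ar Bs D"
      by (rule canonical_interp_take[OF assms(2)])
    show "data_system C ar (take (Suc i) Bs)" using assms(2) by (rule data_system_take)
  qed
  fix D
  show "\<exists>\<phi>. sigma_formula n \<phi> \<and> wf_formula 0 \<phi> \<and>
      (\<forall>h. \<forall>t\<in>hyperterms C ar. represents sq code h t \<longrightarrow>
        (holds h [] \<phi> \<longleftrightarrow> t \<in> canonical_interp C ar Bs D))" if type: "sigma_type n Bs D"
  proof -
    obtain i where i: "i < length Bs" "D \<in> set (type_ids (Bs ! i))" "sigma_system n (take (Suc i) Bs)"
      using type unfolding sigma_type_def by blast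
    have "sigma_definable sq code (hyperterms C ar) n (canonical_interp C ar Bs D)"
      using bspec[OF mp[OF conjunct2[OF system_definable(1)[OF assms(1,4) i(3)]]
        take(2)[OF i(1,2)]] take(1)[OF i(1,2)]]
      unfolding take(3)[OF i(1,2)] .
    then show ?thesis by (rule sigma_definable_formulas(1))
  qed
  show "\<exists>\<phi>. pi_formula n \<phi> \<and> wf_formula 0 \<phi> \<and>
      (\<forall>h. \<forall>t\<in>hyperterms C ar. represents sq code h t \<longrightarrow>
        (holds h [] \<phi> \<longleftrightarrow> t \<in> canonical_interp C ar Bs D))" if type: "pi_type n Bs D"
  proof -
    obtain i where i: "i < length Bs" "D \<in> set (type_ids (Bs ! i))" "pi_system n (take (Suc i) Bs)"
      using type unfolding pi_type_def by blast
    have "sigma_definable sq code (hyperterms C ar) n (- canonical_interp C ar Bs D)"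
      using bspec[OF mp[OF conjunct2[OF system_definable(2)[OF assms(1,4) i(3)]]
        take(2)[OF i(1,2)]] take(1)[OF i(1,2)]]
      unfolding take(3)[OF i(1,2)] .
    from sigma_definable_formulas(2)[OF this] show ?thesis unfolding Compl_iff not_not .
  qed
qed

end
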